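(* The fourth power $\vartheta^4(\tau,z)$ of the Jacobi theta series, regarded as a function of weight $2$ and index $2$, satisfies the modular differential equation of degree $3$ $$H_6H_4H_2(\vartheta^4)-\tfrac{23}{4}E_4H_2(\vartheta^4)+\tfrac{81}{4}E_6\vartheta^4=0.$$
   Context: Let $\tau$ lie in the upper half-plane, $z\in\mathbb{C}$, $q=e^{2\pi i\tau}$, $\zeta=e^{2\pi iz}$, $\vartheta(\tau,z)=q^{1/8}\zeta^{1/2}\sum_{n\in\mathbb{Z}}(-1)^nq^{n(n+1)/2}\zeta^n$. $E_2=1-24\sum\sigma_1(n)q^n$, $E_4=1+240\sum\sigma_3(n)q^n$, $E_6=1-504\sum\sigma_5(n)q^n$. For index $m=2$: $H^{(2)}=12q\frac{\partial}{\partial q}-\frac32(\zeta\frac{\partial}{\partial\zeta})^2$, and for a function $\varphi$ of weight $k$ (and index $2$), $H_k(\varphi)=H^{(2)}(\varphi)-\frac{2k-1}{2}E_2\varphi$, of weight $k+2$; $H_6H_4H_2(\varphi)=H_6(H_4(H_2(\varphi)))$. *)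

theory Defs
  imports "HOL-Analysis.Analysis"
begin

text \<open>Jacobi theta series, with q = exp(2 pi i tau), zeta = exp(2 pi i z),
  q^(1/8) = exp(2 pi i tau/8), zeta^(1/2) = exp(pi i z).\<close>
definition jtheta :: "complex \<Rightarrow> complex \<Rightarrow> complex" where
  "jtheta \<tau> z = exp (2 * pi * \<i> * \<tau> / 8) * exp (pi * \<i> * z) *
     (\<Sum>\<^sub>\<infinity>n::int. (-1) powi n * exp (2 * pi * \<i> * \<tau> * of_int (n * (n + 1) div 2))
                          * exp (2 * pi * \<i> * z * of_int n))"

definition divsum :: "nat \<Rightarrow> nat \<Rightarrow> nat" where
  "divsum k n = (\<Sum>d\<in>{d. d dvd n}. d ^ k)"

definition qexp :: "complex \<Rightarrow> nat \<Rightarrow> complex" where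
  "qexp \<tau> n = exp (2 * pi * \<i> * \<tau> * of_nat n)"

definition E2 :: "complex \<Rightarrow> complex" where
  "E2 \<tau> = 1 - 24 * (\<Sum>n. of_nat (divsum 1 (Suc n)) * qexp \<tau> (Suc n))"

definition E4 :: "complex \<Rightarrow> complex" where
  "E4 \<tau> = 1 + 240 * (\<Sum>n. of_nat (divsum 3 (Suc n)) * qexp \<tau> (Suc n))"

definition E6 :: "complex \<Rightarrow> complex" where
  "E6 \<tau> = 1 - 504 * (\<Sum>n. of_nat (divsum 5 (Suc n)) * qexp \<tau> (Suc n))"

text \<open>q d/dq = (1/(2 pi i)) d/d tau;  zeta d/dzeta = (1/(2 pi i)) d/dz.\<close>
definition Dq :: "(complex \<Rightarrow> complex \<Rightarrow> complex) \<Rightarrow> complex \<Rightarrow> complex \<Rightarrow> complex" where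
  "Dq f \<tau> z = deriv (\<lambda>t. f t z) \<tau> / (2 * pi * \<i>)"

definition Dzeta :: "(complex \<Rightarrow> complex \<Rightarrow> complex) \<Rightarrow> complex \<Rightarrow> complex \<Rightarrow> complex" where
  "Dzeta f \<tau> z = deriv (\<lambda>w. f \<tau> w) z / (2 * pi * \<i>)"

definition heat2 :: "(complex \<Rightarrow> complex \<Rightarrow> complex) \<Rightarrow> complex \<Rightarrow> complex \<Rightarrow> complex" where
  "heat2 f \<tau> z = 12 * Dq f \<tau> z - 3/2 * Dzeta (Dzeta f) \<tau> z"

definition Hk :: "nat \<Rightarrow> (complex \<Rightarrow> complex \<Rightarrow> complex) \<Rightarrow> complex \<Rightarrow> complex \<Rightarrow> complex" where
  "Hk k f \<tau> z = heat2 f \<tau> z - (2 * of_nat k - 1) / 2 * E2 \<tau> * f \<tau> z"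

end

theory Submission
  imports Defs
begin

text \<open>
  Write \<open>T\<^sub>k\<close> for the \<open>k\<close>-th \<open>\<zeta> d/d\<zeta>\<close>-derivative of \<open>\<theta>\<close>; the heat equation turns \<open>q d/dq\<close> into
  \<open>T\<^sub>k \<mapsto> T\<^sub>k\<^sub>+\<^sub>2/2\<close>, so all operators act on polynomials in the \<open>T\<^sub>k\<close> and in \<open>E\<^sub>2, E\<^sub>4, E\<^sub>6\<close>.

  In a product of two theta series the substitution \<open>(x, y) \<mapsto> (x + y, x - y)\<close> separates the
  variables, so \<open>\<theta>\<^sup>2\<close> and the Hirota derivatives of \<open>\<theta>\<close> of orders 2, 4 and 6 all lie
  in one two-dimensional space of functions of \<open>z\<close>. The resulting linear relations have coefficients
  that are rational in \<open>t\<^sub>k = T\<^sub>k(\<tau>, 0)\<close>; they are the differential equation of the Weierstrass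
  function and a consequence of it.

  Comparing the theta series with its product expansion expresses \<open>t\<^sub>3/t\<^sub>1\<close>, \<open>t\<^sub>5/t\<^sub>1\<close> and
  \<open>t\<^sub>7/t\<^sub>1\<close> through \<open>E\<^sub>2, E\<^sub>4, E\<^sub>6\<close>, since the logarithmic derivative of the product is a
  Lambert series. Together with the heat equation this also gives Ramanujan's formulas for the
  derivatives of \<open>E\<^sub>2\<close> and \<open>E\<^sub>4\<close>. The theorem is then an identity between polynomials.
\<close>

section \<open>Theta moments\<close>

lemma summable_on_exp_neg_abs_int: "(\<lambda>n::int. exp (- \<bar>real_of_int n\<bar>)) summable_on UNIV"
proof -
  have nat: "(\<lambda>n::nat. exp (- real n)) summable_on UNIV"
  proof (rule norm_summable_imp_summable_on)
    have "summable (\<lambda>n::nat. exp (-1::real) ^ n)"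
      by (rule summable_geometric) simp
    then show "summable (\<lambda>n::nat. norm (exp (- real n)))"
      by (simp flip: exp_of_nat_mult)
  qed
  have 1: "(\<lambda>n::int. exp (- \<bar>real_of_int n\<bar>)) summable_on (range int)"
    using nat by (subst summable_on_reindex) (auto simp: o_def)
  have 2: "(\<lambda>n::int. exp (- \<bar>real_of_int n\<bar>)) summable_on (range (\<lambda>n. - int n))"
    using nat by (subst summable_on_reindex) (auto simp: o_def inj_on_def)
  have "range int \<union> range (\<lambda>n. - int n) = UNIV"
    by (metis (no_types, lifting) UNIV_eq_I Un_iff int_cases2 rangeI)
  then show ?thesis
    using summable_on_union[OF 1 2] by simp
qed

lemma power_le_fact_mult_exp: "x \<ge> 0 \<Longrightarrow> x ^ k \<le> fact k * exp (x::real)"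
proof -
  assume x: "x \<ge> 0"
  have "x ^ k / fact k \<le> exp x"
    using sum_le_suminf[of "\<lambda>j. inverse (fact j) * x ^ j" "{k}"] summable_exp[of x] x
    by (simp add: exp_def scaleR_conv_of_real divide_inverse mult.commute)
  then show ?thesis
    by (simp add: field_simps)
qed

text \<open>The power is absorbed into an exponential factor, and completing the square leaves a
  geometric majorant. The shift \<open>s\<close> covers half-integral as well as integral
  summation.\<close>

lemma summable_on_gaussian_int:
  fixes a b s :: real
  assumes "a > 0"
  shows "(\<lambda>n::int. \<bar>of_int n + s\<bar> ^ k * exp (- a * (of_int n + s)\<^sup>2 + b * \<bar>of_int n + s\<bar>)) summable_on UNIV"
proof (rule summable_on_comparison_test)
  \<comment> \<open>The maximum of \<open>(b + 2) * x - a * x^2\<close> is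
    \<open>(b + 2)^2 / (4 * a)\<close>. Of the added \<open>2 * x\<close>, one half pays for
    \<open>x ^ k\<close> and the other gives the decay; \<open>\<bar>s\<bar>\<close> passes from
    \<open>x\<close> to \<open>\<bar>n\<bar>\<close>.\<close>
  define C where "C = (b + 2)\<^sup>2 / (4 * a) + \<bar>s\<bar>"
  show "(\<lambda>n::int. (fact k * exp C) * exp (- \<bar>real_of_int n\<bar>)) summable_on UNIV"
    by (intro summable_on_cmult_right summable_on_exp_neg_abs_int)
  fix n :: int
  define x where "x = \<bar>of_int n + s\<bar>"
  have x: "x \<ge> 0" by (simp add: x_def)
  have xk: "x ^ k \<le> fact k * exp x"
    using x by (rule power_le_fact_mult_exp)
  have "0 \<le> (2 * a * x - (b + 2))\<^sup>2 / (4 * a)"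
    using assms by simp
  also have "\<dots> = a * x\<^sup>2 - (b + 2) * x + (b + 2)\<^sup>2 / (4 * a)"
    using assms by (simp add: field_simps power2_eq_square)
  finally have "x + (- a * x\<^sup>2 + b * x) \<le> (b + 2)\<^sup>2 / (4 * a) - x"
    by (simp add: algebra_simps)
  also have "\<dots> \<le> C - \<bar>real_of_int n\<bar>"
    by (simp add: C_def x_def)
  finally have e: "exp (x + (- a * x\<^sup>2 + b * x)) \<le> exp (C - \<bar>real_of_int n\<bar>)"
    by simp
  have "x ^ k * exp (- a * x\<^sup>2 + b * x) \<le> (fact k * exp x) * exp (- a * x\<^sup>2 + b * x)"
    using xk by (intro mult_right_mono) auto
  also have "\<dots> = fact k * exp (x + (- a * x\<^sup>2 + b * x))"
    by (simp only: exp_add mult.assoc)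
  also have "\<dots> \<le> fact k * exp (C - \<bar>real_of_int n\<bar>)"
    using e by simp
  finally show "\<bar>of_int n + s\<bar> ^ k * exp (- a * (of_int n + s)\<^sup>2 + b * \<bar>of_int n + s\<bar>) \<le> fact k * exp C * exp (- \<bar>real_of_int n\<bar>)"
    by (simp add: x_def exp_diff exp_minus divide_inverse mult.assoc)
qed auto

section \<open>Termwise differentiation of sums over the integers\<close>

text \<open>Absolute convergence makes the order of summation irrelevant, so the enumeration
  \<open>int_decode\<close> gives access to results on series over the naturals.\<close>

lemma infsum_int_eq_suminf:
  fixes f :: "int \<Rightarrow> 'a :: banach"
  assumes "(\<lambda>n. norm (f n)) summable_on UNIV"
  shows "infsum f UNIV = (\<Sum>n. f (int_decode n))" "summable (\<lambda>n. norm (f (int_decode n)))"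
proof -
  have bij: "bij_betw int_decode UNIV UNIV"
    using bij_int_decode by simp
  have "(f has_sum infsum f UNIV) UNIV"
    using assms abs_summable_summable has_sum_infsum by blast
  then have "((\<lambda>n. f (int_decode n)) has_sum infsum f UNIV) UNIV"
    using has_sum_reindex_bij_betw[OF bij] by blast
  then show "infsum f UNIV = (\<Sum>n. f (int_decode n))"
    using has_sum_imp_sums sums_unique by blast
  have "(\<lambda>n. norm (f (int_decode n))) summable_on UNIV"
    using assms summable_on_reindex_bij_betw[OF bij, of "\<lambda>n. norm (f n)"] by blast
  then show "summable (\<lambda>n. norm (f (int_decode n)))"
    using has_sum_imp_sums has_sum_infsum sums_summable by blast
qed

text \<open>By the Weierstrass test with majorant \<open>M\<close>, the differentiated series
  converges uniformly on \<open>S\<close>.\<close>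

lemma has_field_derivative_infsum_int:
  fixes f f' :: "int \<Rightarrow> complex \<Rightarrow> complex"
  assumes "convex S" "open S" "x \<in> S"
    and f': "\<And>n x. x \<in> S \<Longrightarrow> (f n has_field_derivative f' n x) (at x)"
    and M: "\<And>n x. x \<in> S \<Longrightarrow> norm (f' n x) \<le> M n" "M summable_on UNIV"
    and f: "\<And>x. x \<in> S \<Longrightarrow> (\<lambda>n. norm (f n x)) summable_on UNIV"
  shows "((\<lambda>x. \<Sum>\<^sub>\<infinity>n. f n x) has_field_derivative (\<Sum>\<^sub>\<infinity>n. f' n x)) (at x)"
proof -
  have M0: "M n \<ge> 0" for n
    using M(1)[OF \<open>x \<in> S\<close>] norm_ge_zero order_trans by blast
  have Ms: "(\<lambda>n. norm (M n)) summable_on UNIV"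
    using M(2) M0 by simp
  have Md: "summable (\<lambda>n. M (int_decode n))"
    using infsum_int_eq_suminf(2)[OF Ms] M0 by simp
  have f's: "(\<lambda>n. norm (f' n x)) summable_on UNIV" if "x \<in> S" for x
    using M that M0 by (intro Infinite_Sum.abs_summable_on_comparison_test[OF Ms]) auto
  have "((\<lambda>x. \<Sum>n. f (int_decode n) x) has_field_derivative (\<Sum>n. f' (int_decode n) x)) (at x)"
  proof (rule has_field_derivative_series'(2)[where S = S and ?x0.0 = x])
    show "uniformly_convergent_on S (\<lambda>n x. \<Sum>i<n. f' (int_decode i) x)"
      using M(1) by (intro Weierstrass_m_test'[OF _ Md]) auto
    show "summable (\<lambda>n. f (int_decode n) x)"
      by (rule summable_norm_cancel[OF infsum_int_eq_suminf(2)[OF f[OF \<open>x \<in> S\<close>]]])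
    show "x \<in> interior S"
      using assms by (simp add: interior_open)
    show "(f (int_decode n) has_field_derivative f' (int_decode n) x) (at x within S)" if "x \<in> S" for n x
      by (rule has_field_derivative_at_within[OF f'[OF that]])
  qed (use assms in auto)
  moreover have "(\<Sum>n. f (int_decode n) x) = (\<Sum>\<^sub>\<infinity>n. f n x)" if "x \<in> S" for x
    using infsum_int_eq_suminf(1)[OF f[OF that]] by simp
  moreover have "(\<Sum>n. f' (int_decode n) x) = (\<Sum>\<^sub>\<infinity>n. f' n x)"
    using infsum_int_eq_suminf(1)[OF f's[OF \<open>x \<in> S\<close>]] by simp
  ultimately show ?thesis
    using has_field_derivative_transform_within_open[OF _ \<open>open S\<close> \<open>x \<in> S\<close>, of "\<lambda>x. \<Sum>n. f (int_decode n) x"]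
    by auto
qed

section \<open>Moments of the theta series and the heat equation\<close>

text \<open>Since \<open>n * (n + 1) / 2 + 1/8 = (n + 1/2)^2 / 2\<close>, the prefactors of
  \<open>jtheta\<close> disappear into half-integral exponents. The power \<open>k\<close> counts
  applications of zeta d/dzeta.\<close>

definition theta_term :: "nat \<Rightarrow> complex \<Rightarrow> complex \<Rightarrow> int \<Rightarrow> complex" where
  "theta_term k \<tau> z n = (-1) powi n * (of_int n + 1/2) ^ k
     * exp (pi * \<i> * \<tau> * (of_int n + 1/2)\<^sup>2 + 2 * pi * \<i> * z * (of_int n + 1/2))"

definition theta_moment :: "nat \<Rightarrow> complex \<Rightarrow> complex \<Rightarrow> complex" where
  "theta_moment k \<tau> z = (\<Sum>\<^sub>\<infinity>n. theta_term k \<tau> z n)"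

lemma jtheta_eq_theta_moment: "jtheta \<tau> z = theta_moment 0 \<tau> z"
proof -
  have "exp (2 * pi * \<i> * \<tau> / 8) * exp (pi * \<i> * z) * ((-1) powi n * exp (2 * pi * \<i> * \<tau> * of_int (n * (n + 1) div 2))
                          * exp (2 * pi * \<i> * z * of_int n)) = theta_term 0 \<tau> z n" for n
  proof -
    define m where "m = n * (n + 1) div 2"
    \<comment> \<open>The division is exact because one of two consecutive integers is even.\<close>
    have "2 * m = n * (n + 1)"
      unfolding m_def by (subst dvd_mult_div_cancel) auto
    then have "(of_int (2 * m) :: complex) = of_int (n * (n + 1))"
      by simp
    then have h: "(of_int m :: complex) = (of_int n ^ 2 + of_int n) / 2"
      by (simp add: field_simps power2_eq_square)
    have "exp (pi * \<i> * \<tau> * (of_int n + 1/2)\<^sup>2 + 2 * pi * \<i> * z * (of_int n + 1/2))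
       = exp (2 * pi * \<i> * \<tau> / 8 + pi * \<i> * z + 2 * pi * \<i> * \<tau> * of_int m + 2 * pi * \<i> * z * of_int n)"
      unfolding h by (rule arg_cong[where f = exp]) (simp add: field_simps power2_eq_square)
    then show ?thesis
      unfolding theta_term_def m_def[symmetric] by (simp add: exp_add mult_ac)
  qed
  then show ?thesis
    unfolding jtheta_def theta_moment_def by (subst infsum_cmult_right'[symmetric]) simp
qed

text \<open>Only imaginary parts affect the modulus. The factors \<open>c\<close> and
  \<open>d\<close> stay free so that the bound serves both \<open>theta_term\<close> and
  \<open>lattice_term\<close>.\<close>

lemma norm_exp_quadratic_le:
  fixes \<tau> z :: complex and x c d :: real
  assumes "a \<le> Im \<tau>" "\<bar>Im z\<bar> \<le> b" "c \<ge> 0" "d \<ge> 0"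
  shows "norm (exp (c * \<i> * \<tau> * of_real x ^ 2 + d * \<i> * z * of_real x)) \<le> exp (- (c * a) * x\<^sup>2 + d * b * \<bar>x\<bar>)"
proof -
  have "- (Im z * x) \<le> \<bar>Im z\<bar> * \<bar>x\<bar>"
    by (metis abs_ge_minus_self abs_mult)
  also have "\<dots> \<le> b * \<bar>x\<bar>"
    using assms by (intro mult_right_mono) auto
  finally have "d * - (Im z * x) \<le> d * (b * \<bar>x\<bar>)"
    using assms by (intro mult_left_mono)
  moreover have "c * x\<^sup>2 * a \<le> c * x\<^sup>2 * Im \<tau>"
    using assms by (intro mult_left_mono) auto
  ultimately show ?thesis
    by (simp add: Re_power2 Im_power2 algebra_simps flip: of_real_power)
qed

text \<open>The bound depends on the two variables only through \<open>a\<close> and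
  \<open>b\<close>, so it can serve as a uniform majorant.\<close>

lemma norm_theta_term_le:
  assumes "a \<le> Im \<tau>" "\<bar>Im z\<bar> \<le> b"
  shows "norm (theta_term k \<tau> z n)
    \<le> \<bar>of_int n + 1/2\<bar> ^ k * exp (- (pi * a) * (of_int n + 1/2)\<^sup>2 + 2 * pi * b * \<bar>of_int n + 1/2\<bar>)"
proof -
  define x where "x = (of_int n + 1/2 :: real)"
  have x: "(of_int n + 1/2 :: complex) = of_real x"
    by (simp add: x_def)
  show ?thesis
    using norm_exp_quadratic_le[OF assms, of pi "2 * pi" x]
    unfolding theta_term_def x x_def[symmetric]
    by (simp add: norm_mult norm_power norm_power_int mult_left_mono)
qed

lemma theta_term_abs_summable:
  assumes "Im \<tau> > 0"
  shows "(\<lambda>n. norm (theta_term k \<tau> z n)) summable_on UNIV"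
proof (rule Infinite_Sum.abs_summable_on_comparison_test')
  show "(\<lambda>n::int. \<bar>of_int n + 1/2\<bar> ^ k * exp (- (pi * Im \<tau>) * (of_int n + 1/2)\<^sup>2
      + 2 * pi * \<bar>Im z\<bar> * \<bar>of_int n + 1/2\<bar>)) summable_on UNIV"
    using assms by (intro summable_on_gaussian_int) simp
qed (rule norm_theta_term_le; simp)

lemma theta_moment_has_field_derivative_z:
  assumes "Im \<tau> > 0"
  shows "((\<lambda>z. theta_moment k \<tau> z) has_field_derivative 2 * pi * \<i> * theta_moment (Suc k) \<tau> z) (at z)"
proof -
  \<comment> \<open>This bounds the imaginary part on the whole unit ball about
    \<open>z\<close>.\<close>
  define b where "b = \<bar>Im z\<bar> + 1"
  define M where "M = (\<lambda>n::int. norm (2 * pi * \<i>) * (\<bar>of_int n + 1/2\<bar> ^ Suc k * exp (- (pi * Im \<tau>) * (of_int n + 1/2)\<^sup>2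
      + 2 * pi * b * \<bar>of_int n + 1/2\<bar>)))"
  have "((\<lambda>z. theta_moment k \<tau> z) has_field_derivative (\<Sum>\<^sub>\<infinity>n. 2 * pi * \<i> * theta_term (Suc k) \<tau> z n)) (at z)"
    unfolding theta_moment_def
  proof (rule has_field_derivative_infsum_int)
    show "convex (ball z 1)" "open (ball z 1)" "z \<in> ball z 1"
      by auto
    show "M summable_on UNIV"
      unfolding M_def using assms by (intro summable_on_cmult_right summable_on_gaussian_int) simp
    show "norm (2 * pi * \<i> * theta_term (Suc k) \<tau> w n) \<le> M n" if "w \<in> ball z 1" for n w
    proof -
      have "\<bar>Im (z - w)\<bar> < 1"
        using that abs_Im_le_cmod[of "z - w"] by (simp add: dist_norm)
      then have "\<bar>Im w\<bar> \<le> b"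
        by (simp add: b_def)
      then have "norm (theta_term (Suc k) \<tau> w n) \<le> \<bar>of_int n + 1/2\<bar> ^ Suc k * exp (- (pi * Im \<tau>) * (of_int n + 1/2)\<^sup>2
      + 2 * pi * b * \<bar>of_int n + 1/2\<bar>)"
        by (intro norm_theta_term_le) auto
      then show ?thesis
        unfolding M_def by (subst norm_mult) (intro mult_left_mono, auto)
    qed
    show "((\<lambda>z. theta_term k \<tau> z n) has_field_derivative 2 * pi * \<i> * theta_term (Suc k) \<tau> w n) (at w)" for n w
      unfolding theta_term_def by (auto intro!: derivative_eq_intros)
    show "(\<lambda>n. norm (theta_term k \<tau> w n)) summable_on UNIV" for w
      using assms by (rule theta_term_abs_summable)
  qed
  then show ?thesis
    unfolding theta_moment_def by (simp add: infsum_cmult_right')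
qed

text \<open>This is the heat equation: differentiating the exponent in tau brings down
  \<open>pi * \<i> * (n + 1/2)^2\<close>, that is, two further factors
  \<open>n + 1/2\<close>.\<close>

lemma theta_moment_has_field_derivative_tau:
  assumes "Im \<tau> > 0"
  shows "((\<lambda>\<tau>. theta_moment k \<tau> z) has_field_derivative pi * \<i> * theta_moment (k + 2) \<tau> z) (at \<tau>)"
proof -
  \<comment> \<open>On the ball of radius \<open>a\<close> the imaginary part stays at least
    \<open>a\<close>, so one Gaussian majorant suffices.\<close>
  define a where "a = Im \<tau> / 2"
  have a: "a > 0" using assms by (simp add: a_def)
  define M where "M = (\<lambda>n::int. norm (pi * \<i>) * (\<bar>of_int n + 1/2\<bar> ^ (k + 2) * exp (- (pi * a) * (of_int n + 1/2)\<^sup>2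
      + 2 * pi * \<bar>Im z\<bar> * \<bar>of_int n + 1/2\<bar>)))"
  have in_ball: "a \<le> Im t" if "t \<in> ball \<tau> a" for t
  proof -
    have "\<bar>Im (\<tau> - t)\<bar> < a"
      using that abs_Im_le_cmod[of "\<tau> - t"] by (simp add: dist_norm)
    then show ?thesis
      by (simp add: a_def abs_if split: if_splits)
  qed
  have "((\<lambda>\<tau>. theta_moment k \<tau> z) has_field_derivative (\<Sum>\<^sub>\<infinity>n. pi * \<i> * theta_term (k + 2) \<tau> z n)) (at \<tau>)"
    unfolding theta_moment_def
  proof (rule has_field_derivative_infsum_int)
    show "convex (ball \<tau> a)" "open (ball \<tau> a)" "\<tau> \<in> ball \<tau> a"
      using a by auto
    show "M summable_on UNIV"
      unfolding M_def using a by (intro summable_on_cmult_right summable_on_gaussian_int) simp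
    show "norm (pi * \<i> * theta_term (k + 2) t z n) \<le> M n" if "t \<in> ball \<tau> a" for n t
    proof -
      have "norm (theta_term (k + 2) t z n) \<le> \<bar>of_int n + 1/2\<bar> ^ (k + 2) * exp (- (pi * a) * (of_int n + 1/2)\<^sup>2
      + 2 * pi * \<bar>Im z\<bar> * \<bar>of_int n + 1/2\<bar>)"
        using in_ball[OF that] by (intro norm_theta_term_le) auto
      then show ?thesis
        unfolding M_def by (subst norm_mult) (intro mult_left_mono, auto)
    qed
    show "((\<lambda>t. theta_term k t z n) has_field_derivative pi * \<i> * theta_term (k + 2) t z n) (at t)" for n t
      unfolding theta_term_def by (auto intro!: derivative_eq_intros simp: power_add power2_eq_square)
    show "(\<lambda>n. norm (theta_term k t z n)) summable_on UNIV" if "t \<in> ball \<tau> a" for t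
      using in_ball[OF that] a by (intro theta_term_abs_summable) auto
  qed
  then show ?thesis
    unfolding theta_moment_def by (simp add: infsum_cmult_right')
qed

section \<open>Bilinear relations\<close>

lemma has_sum_product:
  fixes f g :: "'a \<Rightarrow> complex"
  assumes f: "(\<lambda>x. norm (f x)) summable_on A" and g: "(\<lambda>y. norm (g y)) summable_on B"
  shows "((\<lambda>(x, y). f x * g y) has_sum infsum f A * infsum g B) (A \<times> B)"
proof (rule has_sum_SigmaI)
  have fs: "f summable_on A" and gs: "g summable_on B"
    using f g abs_summable_summable by blast+
  show "((\<lambda>y. case (x, y) of (x, y) \<Rightarrow> f x * g y) has_sum f x * infsum g B) B" for x
    using has_sum_cmult_right[OF has_sum_infsum[OF gs]] by simp
  show "((\<lambda>x. f x * infsum g B) has_sum infsum f A * infsum g B) A"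
    by (intro has_sum_cmult_left has_sum_infsum fs)
  have "(\<lambda>p. norm (case p of (x, y) \<Rightarrow> f x * g y)) summable_on A \<times> B"
  proof (rule summable_on_SigmaI)
    show "((\<lambda>y. norm (case (x, y) of (x, y) \<Rightarrow> f x * g y)) has_sum norm (f x) * infsum (\<lambda>y. norm (g y)) B) B" for x
      using has_sum_cmult_right[OF has_sum_infsum[OF g]] by (simp add: norm_mult)
    show "(\<lambda>x. norm (f x) * infsum (\<lambda>y. norm (g y)) B) summable_on A"
      by (intro summable_on_cmult_left f)
  qed auto
  then show "(\<lambda>(x, y). f x * g y) summable_on A \<times> B"
    by (rule abs_summable_summable)
qed

text \<open>A list of triples \<open>(c, a, b)\<close> encodes the polynomial with terms
  \<open>c * x ^ a * y ^ b\<close>, here at \<open>x = m + 1/2\<close> and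
  \<open>y = n + 1/2\<close>. Thus one statement covers every quadratic expression in the
  moments.\<close>

lemma has_sum_theta_pairs:
  assumes "Im \<tau> > 0"
  shows "((\<lambda>(m, n). (\<Sum>(c, a, b)\<leftarrow>l. c * (of_int m + 1/2) ^ a * (of_int n + 1/2) ^ b)
            * (theta_term 0 \<tau> z m * theta_term 0 \<tau> z n))
          has_sum (\<Sum>(c, a, b)\<leftarrow>l. c * theta_moment a \<tau> z * theta_moment b \<tau> z)) UNIV"
proof (induction l)
  case Nil
  show ?case by (simp add: case_prod_unfold)
next
  case (Cons p l)
  obtain c a b where p: "p = (c, a, b)"
    by (cases p) auto
  have "((\<lambda>(m, n). theta_term a \<tau> z m * theta_term b \<tau> z n) has_sum
      theta_moment a \<tau> z * theta_moment b \<tau> z) (UNIV \<times> UNIV)"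
    unfolding theta_moment_def by (intro has_sum_product theta_term_abs_summable assms)
  from has_sum_add[OF has_sum_cmult_right[OF this, of c, unfolded UNIV_Times_UNIV] Cons.IH]
  show ?case
    by (simp add: p case_prod_unfold theta_term_def algebra_simps)
qed

section \<open>Separation of variables in products of two theta series\<close>

text \<open>With \<open>N = x + y\<close> and \<open>M = x - y\<close> one has
  \<open>x^2 + y^2 = (N^2 + M^2) / 2\<close>, whence the factor \<open>pi / 2\<close>.\<close>

definition lattice_term :: "nat \<Rightarrow> complex \<Rightarrow> complex \<Rightarrow> int \<Rightarrow> complex" where
  "lattice_term i \<tau> z N = of_int N ^ i * exp (pi / 2 * \<i> * \<tau> * (of_int N)\<^sup>2 + 2 * pi * \<i> * z * of_int N)"

text \<open>For \<open>i = 0\<close> the even and odd sums are Jacobi's theta functions theta_3 and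
  theta_2 at (2 tau, 2 z).\<close>

definition even_moment :: "nat \<Rightarrow> complex \<Rightarrow> complex \<Rightarrow> complex" where
  "even_moment i \<tau> z = (\<Sum>\<^sub>\<infinity>N\<in>{N. even N}. lattice_term i \<tau> z N)"

definition odd_moment :: "nat \<Rightarrow> complex \<Rightarrow> complex \<Rightarrow> complex" where
  "odd_moment i \<tau> z = (\<Sum>\<^sub>\<infinity>N\<in>{N. odd N}. lattice_term i \<tau> z N)"

lemma lattice_term_abs_summable:
  assumes "Im \<tau> > 0"
  shows "(\<lambda>N. norm (lattice_term i \<tau> z N)) summable_on A"
proof (rule summable_on_subset_banach)
  show "(\<lambda>N. norm (lattice_term i \<tau> z N)) summable_on UNIV"
  proof (rule Infinite_Sum.abs_summable_on_comparison_test')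
    show "(\<lambda>n::int. \<bar>of_int n + 0\<bar> ^ i * exp (- (pi / 2 * Im \<tau>) * (of_int n + 0)\<^sup>2
      + 2 * pi * \<bar>Im z\<bar> * \<bar>of_int n + 0\<bar>)) summable_on UNIV"
      using assms by (intro summable_on_gaussian_int) simp
    show "norm (lattice_term i \<tau> z n) \<le> \<bar>of_int n + 0\<bar> ^ i * exp (- (pi / 2 * Im \<tau>) * (of_int n + 0)\<^sup>2
      + 2 * pi * \<bar>Im z\<bar> * \<bar>of_int n + 0\<bar>)" for n :: int
      using norm_exp_quadratic_le[of "Im \<tau>" \<tau> z "\<bar>Im z\<bar>" "pi/2" "2 * pi" "of_int n"]
      unfolding lattice_term_def by (simp add: norm_mult norm_power mult_left_mono)
  qed
qed auto

text \<open>The cross terms of the quadratic form cancel, and \<open>z\<close> multiplies only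
  \<open>m + n + 1\<close>, so the second factor is taken at \<open>z = 0\<close>. The sign depends
  only on the parity of \<open>m + n\<close>.\<close>

lemma theta_term_mult:
  "theta_term 0 \<tau> z m * theta_term 0 \<tau> z n =
     (if even (m + n) then 1 else -1) * (lattice_term 0 \<tau> z (m + n + 1) * lattice_term 0 \<tau> 0 (m - n))"
proof -
  have "(-1) powi m * (-1) powi n = (if even (m + n) then 1 else -1 :: complex)"
    by (auto simp: power_int_minus_left)
  moreover have "exp (pi * \<i> * \<tau> * (of_int m + 1/2)\<^sup>2 + 2 * pi * \<i> * z * (of_int m + 1/2))
      * exp (pi * \<i> * \<tau> * (of_int n + 1/2)\<^sup>2 + 2 * pi * \<i> * z * (of_int n + 1/2))
    = lattice_term 0 \<tau> z (m + n + 1) * lattice_term 0 \<tau> 0 (m - n)"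
    unfolding lattice_term_def
    by (simp add: exp_add[symmetric]) (rule arg_cong[where f = exp], simp add: field_simps power2_eq_square)
  moreover have "theta_term 0 \<tau> z m * theta_term 0 \<tau> z n = ((-1) powi m * (-1) powi n) *
     (exp (pi * \<i> * \<tau> * (of_int m + 1/2)\<^sup>2 + 2 * pi * \<i> * z * (of_int m + 1/2))
      * exp (pi * \<i> * \<tau> * (of_int n + 1/2)\<^sup>2 + 2 * pi * \<i> * z * (of_int n + 1/2)))"
    unfolding theta_term_def by (simp only: power_0 mult_1_right mult_1_left mult_ac)
  ultimately show ?thesis
    by simp
qed

text \<open>The substitution \<open>N = x + y\<close>, \<open>M = x - y\<close> separates the variables, with \<open>N\<close> and \<open>M\<close> of
  opposite parity.\<close>

lemma theta_bilinear:
  assumes "Im \<tau> > 0"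
    and l: "\<And>x y :: complex. (\<Sum>(c, a, b)\<leftarrow>l. c * x ^ a * y ^ b) = (x + y) ^ i * (x - y) ^ k"
  shows "(\<Sum>(c, a, b)\<leftarrow>l. c * theta_moment a \<tau> z * theta_moment b \<tau> z)
    = odd_moment i \<tau> z * even_moment k \<tau> 0 - even_moment i \<tau> z * odd_moment k \<tau> 0"
proof -
  define Ev Od where "Ev = {N::int. even N}" and "Od = {N::int. odd N}"
  \<comment> \<open>\<open>N = m + n + 1\<close> is odd exactly when \<open>m + n\<close> is even,
    so the sign is a function of \<open>N\<close> alone.\<close>
  define f where "f = (\<lambda>(N, M). (if odd N then 1 else -1) * (lattice_term i \<tau> z N * lattice_term k \<tau> 0 M))"
  have "((\<lambda>(N, M). lattice_term i \<tau> z N * lattice_term k \<tau> 0 M) has_sum odd_moment i \<tau> z * even_moment k \<tau> 0) (Od \<times> Ev)"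
    unfolding odd_moment_def even_moment_def Ev_def Od_def
    by (intro has_sum_product lattice_term_abs_summable assms)
  then have 1: "(f has_sum odd_moment i \<tau> z * even_moment k \<tau> 0) (Od \<times> Ev)"
    by (rule has_sum_cong[THEN iffD1, rotated]) (auto simp: f_def Od_def)
  have "((\<lambda>(N, M). lattice_term i \<tau> z N * lattice_term k \<tau> 0 M) has_sum even_moment i \<tau> z * odd_moment k \<tau> 0) (Ev \<times> Od)"
    unfolding odd_moment_def even_moment_def Ev_def Od_def
    by (intro has_sum_product lattice_term_abs_summable assms)
  then have "((\<lambda>p. - (case p of (N, M) \<Rightarrow> lattice_term i \<tau> z N * lattice_term k \<tau> 0 M)) has_sum
      - (even_moment i \<tau> z * odd_moment k \<tau> 0)) (Ev \<times> Od)"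
    by (simp add: has_sum_uminus)
  then have 2: "(f has_sum - (even_moment i \<tau> z * odd_moment k \<tau> 0)) (Ev \<times> Od)"
    by (rule has_sum_cong[THEN iffD1, rotated]) (auto simp: f_def Ev_def)
  have 3: "(f has_sum odd_moment i \<tau> z * even_moment k \<tau> 0 - even_moment i \<tau> z * odd_moment k \<tau> 0)
     (Od \<times> Ev \<union> Ev \<times> Od)"
    using has_sum_Un_disjoint[OF 1 2] by (auto simp: Ev_def Od_def)
  \<comment> \<open>The halves in the inverse map are exact because \<open>N\<close> and
    \<open>M\<close> have opposite parity.\<close>
  have bij: "bij_betw (\<lambda>(m, n). (m + n + 1, m - n)) UNIV (Od \<times> Ev \<union> Ev \<times> Od)"
    by (rule bij_betwI[where g = "\<lambda>(N, M). ((N + M - 1) div 2, (N - M - 1) div 2)"])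
       (auto simp: Ev_def Od_def, presburger+)
  have "f (m + n + 1, m - n) = (\<Sum>(c, a, b)\<leftarrow>l. c * (of_int m + 1/2) ^ a * (of_int n + 1/2) ^ b)
            * (theta_term 0 \<tau> z m * theta_term 0 \<tau> z n)" for m n
    by (simp add: l theta_term_mult) (simp add: f_def lattice_term_def add_ac)
  then have "((\<lambda>(m, n). (\<Sum>(c, a, b)\<leftarrow>l. c * (of_int m + 1/2) ^ a * (of_int n + 1/2) ^ b)
            * (theta_term 0 \<tau> z m * theta_term 0 \<tau> z n)) has_sum
     odd_moment i \<tau> z * even_moment k \<tau> 0 - even_moment i \<tau> z * odd_moment k \<tau> 0) UNIV"
    using has_sum_reindex_bij_betw[OF bij, of f] 3 by (simp add: case_prod_unfold)
  then show ?thesis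
    using has_sum_theta_pairs[OF assms(1), of l z] has_sum_unique by blast
qed

text \<open>Theta is odd in \<open>z\<close>: the involution \<open>n \<mapsto> - 1 - n\<close>
  negates \<open>n + 1/2\<close> and flips the sign \<open>(-1) powi n\<close>.\<close>

lemma theta_moment_even_0: "even k \<Longrightarrow> theta_moment k \<tau> 0 = 0"
proof -
  assume k: "even k"
  have bij: "bij_betw (\<lambda>n::int. - 1 - n) UNIV UNIV"
    by (rule bij_betwI[where g = "\<lambda>n. - 1 - n"]) auto
  have "theta_term k \<tau> 0 (- 1 - n) = - theta_term k \<tau> 0 n" for n
  proof -
    have x: "of_int (- 1 - n) + 1/2 = - (of_int n + 1/2 :: complex)"
      by simp
    have "(-1) powi (- 1 - n) = - ((-1) powi n :: complex)"
      by (auto simp: power_int_minus_left)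
    then show ?thesis
      unfolding theta_term_def x power_minus_even[OF k] power2_minus by simp
  qed
  then have "theta_moment k \<tau> 0 = - theta_moment k \<tau> 0"
    using infsum_reindex_bij_betw[OF bij, of "theta_term k \<tau> 0"]
    by (simp add: theta_moment_def infsum_uminus)
  then show ?thesis by simp
qed

section \<open>Hirota derivatives and the linear relations between them\<close>

text \<open>This and the next two are half the Hirota derivatives of theta with itself, of orders 2,
  4 and 6. The first equals theta^2 (log theta)''.\<close>

definition hirota2 :: "complex \<Rightarrow> complex \<Rightarrow> complex" where
  "hirota2 \<tau> z = theta_moment 0 \<tau> z * theta_moment 2 \<tau> z - theta_moment 1 \<tau> z ^ 2"

definition hirota4 :: "complex \<Rightarrow> complex \<Rightarrow> complex" where
  "hirota4 \<tau> z = theta_moment 0 \<tau> z * theta_moment 4 \<tau> z - 4 * theta_moment 1 \<tau> z * theta_moment 3 \<tau> z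
     + 3 * theta_moment 2 \<tau> z ^ 2"

definition hirota6 :: "complex \<Rightarrow> complex \<Rightarrow> complex" where
  "hirota6 \<tau> z = theta_moment 0 \<tau> z * theta_moment 6 \<tau> z - 6 * theta_moment 1 \<tau> z * theta_moment 5 \<tau> z
     + 15 * theta_moment 2 \<tau> z * theta_moment 4 \<tau> z - 10 * theta_moment 3 \<tau> z ^ 2"

text \<open>The lists expand \<open>(x - y) ^ k\<close> for \<open>k = 0, 2, 4, 6\<close>. The
  dependence on \<open>z\<close> is always through the same two functions,
  \<open>odd_moment 0\<close> and \<open>even_moment 0\<close>.\<close>

lemma hirota_bilinear:
  assumes "Im \<tau> > 0"
  shows "theta_moment 0 \<tau> z ^ 2 = odd_moment 0 \<tau> z * even_moment 0 \<tau> 0 - even_moment 0 \<tau> z * odd_moment 0 \<tau> 0"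
    and "2 * hirota2 \<tau> z = odd_moment 0 \<tau> z * even_moment 2 \<tau> 0 - even_moment 0 \<tau> z * odd_moment 2 \<tau> 0"
    and "2 * hirota4 \<tau> z = odd_moment 0 \<tau> z * even_moment 4 \<tau> 0 - even_moment 0 \<tau> z * odd_moment 4 \<tau> 0"
    and "2 * hirota6 \<tau> z = odd_moment 0 \<tau> z * even_moment 6 \<tau> 0 - even_moment 0 \<tau> z * odd_moment 6 \<tau> 0"
  using theta_bilinear[OF assms, of "[(1, 0, 0)]" 0 0 z]
    theta_bilinear[OF assms, of "[(1, 2, 0), (-2, 1, 1), (1, 0, 2)]" 0 2 z]
    theta_bilinear[OF assms, of "[(1, 4, 0), (-4, 3, 1), (6, 2, 2), (-4, 1, 3), (1, 0, 4)]" 0 4 z]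
    theta_bilinear[OF assms, of "[(1, 6, 0), (-6, 5, 1), (15, 4, 2), (-20, 3, 3), (15, 2, 4), (-6, 1, 5), (1, 0, 6)]" 0 6 z]
  by (simp_all add: hirota2_def hirota4_def hirota6_def algebra_simps power2_eq_square power4_eq_xxxx eval_nat_numeral)

text \<open>The lists expand \<open>(x + y) ^ i * (x - y) ^ k\<close>; at \<open>z = 0\<close> only
  products of two odd moments survive. These minors are the coefficients needed to eliminate the two
  functions of \<open>z\<close>.\<close>

lemma moment_minors:
  assumes "Im \<tau> > 0"
  defines "a \<equiv> \<lambda>k. even_moment k \<tau> 0" and "b \<equiv> \<lambda>k. odd_moment k \<tau> 0"
    and "t \<equiv> \<lambda>k. theta_moment k \<tau> 0"
  shows "b 2 * a 0 - a 2 * b 0 = 2 * t 1 ^ 2"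
    and "b 4 * a 0 - a 4 * b 0 = 8 * t 1 * t 3"
    and "b 6 * a 0 - a 6 * b 0 = 12 * t 1 * t 5 + 20 * t 3 ^ 2"
    and "b 4 * a 2 - a 4 * b 2 = 4 * t 1 * t 5 - 4 * t 3 ^ 2"
    and "b 6 * a 2 - a 6 * b 2 = 8 * t 1 * t 7 - 8 * t 3 * t 5"
  using theta_bilinear[OF assms(1), of "[(1, 2, 0), (2, 1, 1), (1, 0, 2)]" 2 0 0]
    theta_bilinear[OF assms(1), of "[(1, 4, 0), (4, 3, 1), (6, 2, 2), (4, 1, 3), (1, 0, 4)]" 4 0 0]
    theta_bilinear[OF assms(1), of "[(1, 6, 0), (6, 5, 1), (15, 4, 2), (20, 3, 3), (15, 2, 4), (6, 1, 5), (1, 0, 6)]" 6 0 0]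
    theta_bilinear[OF assms(1), of "[(1, 6, 0), (2, 5, 1), (-1, 4, 2), (-4, 3, 3), (-1, 2, 4), (2, 1, 5), (1, 0, 6)]" 4 2 0]
    theta_bilinear[OF assms(1), of "[(1, 8, 0), (4, 7, 1), (4, 6, 2), (-4, 5, 3), (-10, 4, 4), (-4, 3, 5), (4, 2, 6), (4, 1, 7), (1, 0, 8)]" 6 2 0]
  by (simp_all add: a_def b_def t_def theta_moment_even_0 algebra_simps power2_eq_square power4_eq_xxxx eval_nat_numeral)
     (simp add: theta_moment_even_0)

text \<open>The Pluecker relations between the minors \<open>b\<^sub>i a\<^sub>j - a\<^sub>i b\<^sub>j\<close>.\<close>

lemma hirota_relations:
  assumes "Im \<tau> > 0"
  defines "t \<equiv> \<lambda>k. theta_moment k \<tau> 0"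
  shows "t 1 ^ 2 * hirota4 \<tau> z = 4 * t 1 * t 3 * hirota2 \<tau> z - (t 1 * t 5 - t 3 ^ 2) * theta_moment 0 \<tau> z ^ 2"
    and "t 1 ^ 2 * hirota6 \<tau> z = (6 * t 1 * t 5 + 10 * t 3 ^ 2) * hirota2 \<tau> z - 2 * (t 1 * t 7 - t 3 * t 5) * theta_moment 0 \<tau> z ^ 2"
proof -
  note h = hirota_bilinear[OF assms(1), of z] and m = moment_minors[OF assms(1)]
  \<comment> \<open>The minor with indices 2 and 0 multiplies the left side instead of dividing the
    right; that it does not vanish is shown later, from the product expansion.\<close>
  have "(2 * t 1 ^ 2) * (2 * hirota4 \<tau> z) = (8 * t 1 * t 3) * (2 * hirota2 \<tau> z)
      - (4 * t 1 * t 5 - 4 * t 3 ^ 2) * theta_moment 0 \<tau> z ^ 2"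
    unfolding t_def h(1) h(2) h(3) m[symmetric] by (simp add: algebra_simps)
  then show "t 1 ^ 2 * hirota4 \<tau> z = 4 * t 1 * t 3 * hirota2 \<tau> z - (t 1 * t 5 - t 3 ^ 2) * theta_moment 0 \<tau> z ^ 2"
    by algebra
  have "(2 * t 1 ^ 2) * (2 * hirota6 \<tau> z) = (12 * t 1 * t 5 + 20 * t 3 ^ 2) * (2 * hirota2 \<tau> z)
      - (8 * t 1 * t 7 - 8 * t 3 * t 5) * theta_moment 0 \<tau> z ^ 2"
    unfolding t_def h(1) h(2) h(4) m[symmetric] by (simp add: algebra_simps)
  then show "t 1 ^ 2 * hirota6 \<tau> z = (6 * t 1 * t 5 + 10 * t 3 ^ 2) * hirota2 \<tau> z - 2 * (t 1 * t 7 - t 3 * t 5) * theta_moment 0 \<tau> z ^ 2"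
    by algebra
qed

section \<open>The triple product and Eisenstein series\<close>

unbundle no vec_syntax and fps_syntax

section \<open>Geometric series as power series in u = 2 pi i z\<close>

text \<open>Half of the exponential decay of \<open>r ^ d\<close> absorbs the power of
  \<open>d\<close>, and the other half remains as a geometric majorant.\<close>

lemma summable_power_mult_geometric:
  fixes r :: real
  assumes "0 \<le> r" "r < 1"
  shows "summable (\<lambda>d. r ^ d * real d ^ j)"
proof (cases "r = 0")
  case True
  then show ?thesis
    by (intro summable_finite[of "{0}"]) auto
next
  case False
  define e where "e = - ln r / 2"
  have r: "r > 0" and e: "e > 0"
    using False assms by (auto simp: e_def)
  have re: "r = exp (- 2 * e)"
    using r by (simp add: e_def)
  have "summable (\<lambda>d. (fact j / e ^ j) * exp (- e) ^ d)"
    using e by (intro summable_mult summable_geometric) simp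
  then show ?thesis
  proof (rule summable_comparison_test'[where N = 0])
    fix d :: nat
    have "(e * real d) ^ j \<le> fact j * exp (e * real d)"
      using e by (intro power_le_fact_mult_exp) simp
    then have "real d ^ j \<le> fact j / e ^ j * exp (e * real d)"
      using e by (simp add: field_simps)
    then have "r ^ d * real d ^ j \<le> r ^ d * (fact j / e ^ j * exp (e * real d))"
      using r by (intro mult_left_mono) auto
    also have "\<dots> = fact j / e ^ j * exp (- e) ^ d"
      unfolding re by (simp flip: exp_of_nat_mult exp_add add: algebra_simps)
    finally show "norm (r ^ d * real d ^ j) \<le> fact j / e ^ j * exp (- e) ^ d"
      using r by simp
  qed
qed

text \<open>Each coefficient of a product is a finite sum. The limits of power series taken below
  are all of this coefficientwise kind, in the topology of the complex numbers.\<close>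

lemma fps_mult_nth_tendsto:
  fixes a b :: "nat \<Rightarrow> complex fps"
  assumes "\<And>j. (\<lambda>n. a n $ j) \<longlonglongrightarrow> A $ j" "\<And>j. (\<lambda>n. b n $ j) \<longlonglongrightarrow> B $ j"
  shows "(\<lambda>n. (a n * b n) $ j) \<longlonglongrightarrow> (A * B) $ j"
  unfolding fps_mult_nth by (intro tendsto_sum tendsto_mult assms)

text \<open>The expansion in u of \<open>y / (1 - y)\<close>, the sum of all \<open>y ^ d\<close>
  with \<open>d \<ge> 1\<close>, for y = q exp(s u).\<close>

definition geom_fps :: "complex \<Rightarrow> complex \<Rightarrow> complex fps" where
  "geom_fps s q = Abs_fps (\<lambda>j. (\<Sum>d. q ^ Suc d * (s * of_nat (Suc d)) ^ j) / fact j)"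

lemma summable_geom_fps:
  fixes q s :: complex
  assumes "norm q < 1"
  shows "summable (\<lambda>d. q ^ Suc d * (s * of_nat (Suc d)) ^ j)"
proof -
  have "summable (\<lambda>d. norm s ^ j * (norm q ^ d * real d ^ j))"
    using assms by (intro summable_mult summable_power_mult_geometric) auto
  then have "summable (\<lambda>d. norm s ^ j * (norm q ^ Suc d * real (Suc d) ^ j))"
    by (subst summable_Suc_iff)
  also have "(\<lambda>d. norm s ^ j * (norm q ^ Suc d * real (Suc d) ^ j)) = (\<lambda>d. norm (q ^ Suc d * (s * of_nat (Suc d)) ^ j))"
    unfolding norm_mult norm_power norm_of_nat power_mult_distrib by (simp only: mult_ac)
  finally show ?thesis
    by (rule summable_norm_cancel)
qed

text \<open>The constant term \<open>q\<close> of the ratio is in general nonzero, so the geometric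
  series does not converge formally. Instead the finite geometric identity is passed to the limit
  coefficient by coefficient.\<close>

lemma geom_fps_eq:
  assumes "norm q < 1"
  shows "(1 - fps_const q * fps_exp s) * geom_fps s q = fps_const q * fps_exp s"
proof (rule fps_ext)
  fix j
  define y where "y = fps_const q * fps_exp s"
  have y: "y ^ d = fps_const (q ^ d) * fps_exp (of_nat d * s)" for d
    by (simp add: y_def power_mult_distrib fps_const_power fps_exp_power_mult)
  have geom: "(1 - y) * (\<Sum>d<D. y ^ Suc d) = y - y ^ Suc D" for D
    by (induction D) (simp_all add: distrib_left, simp add: algebra_simps)
  have "(\<lambda>D. (\<Sum>d<D. y ^ Suc d) $ i) \<longlonglongrightarrow> geom_fps s q $ i" for i
  proof -
    have "(\<lambda>D. (\<Sum>d<D. q ^ Suc d * (s * of_nat (Suc d)) ^ i) / fact i) \<longlonglongrightarrow> geom_fps s q $ i"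
      unfolding geom_fps_def fps_nth_Abs_fps
      by (intro tendsto_divide summable_LIMSEQ summable_geom_fps assms tendsto_const) simp
    moreover have "(\<Sum>d<D. y ^ Suc d) $ i = (\<Sum>d<D. q ^ Suc d * (s * of_nat (Suc d)) ^ i) / fact i" for D
      unfolding fps_sum_nth y sum_divide_distrib
      by (intro sum.cong refl) (simp add: mult.commute[of s] del: power_Suc of_nat_Suc)
    ultimately show ?thesis by simp
  qed
  from fps_mult_nth_tendsto[OF tendsto_const[of "(1 - y) $ _"] this]
  have "(\<lambda>D. (y - y ^ Suc D) $ j) \<longlonglongrightarrow> ((1 - y) * geom_fps s q) $ j"
    by (simp only: geom)
  moreover have "(\<lambda>D. (y - y ^ Suc D) $ j) \<longlonglongrightarrow> y $ j - 0 / fact j"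
  proof -
    have "(\<lambda>D. q ^ Suc D * (s * of_nat (Suc D)) ^ j) \<longlonglongrightarrow> 0"
      using assms by (intro summable_LIMSEQ_zero summable_geom_fps)
    then have "(\<lambda>D. y $ j - q ^ Suc D * (s * of_nat (Suc D)) ^ j / fact j) \<longlonglongrightarrow> y $ j - 0 / fact j"
      by (intro tendsto_intros) auto
    then show ?thesis
      unfolding fps_sub_nth y by (simp add: mult.commute[of s] del: power_Suc of_nat_Suc)
  qed
  ultimately show "((1 - fps_const q * fps_exp s) * geom_fps s q) $ j = (fps_const q * fps_exp s) $ j"
    using LIMSEQ_unique unfolding y_def by fastforce
qed

section \<open>Logarithmic derivative of the truncated product\<close>

text \<open>This is 2 sinh(u/2), that is, zeta^(1/2) - zeta^(-1/2) for zeta = exp(u).\<close>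

definition sinh_fps :: "complex fps" where
  "sinh_fps = fps_exp (1/2) - fps_exp (-1/2)"

text \<open>Jacobi's product for theta, truncated and without the factors independent of
  zeta.\<close>

definition theta_prod_fps :: "complex \<Rightarrow> nat \<Rightarrow> complex fps" where
  "theta_prod_fps q n = sinh_fps * (\<Prod>k=1..n. (1 - fps_const (q ^ k) * fps_exp 1) * (1 - fps_const (q ^ k) * fps_exp (-1)))"

text \<open>Minus the logarithmic derivative of the product over \<open>k\<close>.\<close>

definition lambert_fps :: "complex \<Rightarrow> nat \<Rightarrow> complex fps" where
  "lambert_fps q n = (\<Sum>k=1..n. geom_fps 1 (q ^ k) - geom_fps (-1) (q ^ k))"

text \<open>Logarithmic derivatives of factors add up. The formula is multiplied out because
  \<open>sinh_fps\<close> has constant term 0 and no inverse among power series.\<close>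

lemma theta_prod_fps_deriv:
  assumes "norm q < 1"
  shows "fps_deriv (theta_prod_fps q n) * sinh_fps
    = (fps_deriv sinh_fps - sinh_fps * lambert_fps q n) * theta_prod_fps q n"
proof (induction n)
  case 0
  show ?case by (simp add: theta_prod_fps_def lambert_fps_def)
next
  case (Suc n)
  define P N g h where "P = 1 - fps_const (q ^ Suc n) * fps_exp 1" and "N = 1 - fps_const (q ^ Suc n) * fps_exp (-1)"
    and "g = geom_fps 1 (q ^ Suc n)" and "h = geom_fps (-1) (q ^ Suc n)"
  have "norm (q ^ Suc n) < 1"
    using assms by (simp add: norm_power power_less_one_iff del: power_Suc)
  then have gh: "P * g = fps_const (q ^ Suc n) * fps_exp 1" "N * h = fps_const (q ^ Suc n) * fps_exp (-1)"
    unfolding P_def N_def g_def h_def by (simp_all only: geom_fps_eq)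
  have "fps_deriv P = - (fps_const (q ^ Suc n) * fps_exp 1)" "fps_deriv N = fps_const (q ^ Suc n) * fps_exp (-1)"
    unfolding P_def N_def by (simp_all flip: fps_const_neg)
  then have d: "fps_deriv P = - (P * g)" "fps_deriv N = N * h"
    using gh by simp_all
  have F: "theta_prod_fps q (Suc n) = theta_prod_fps q n * (P * N)"
    by (simp add: theta_prod_fps_def P_def N_def mult.assoc)
  have L: "lambert_fps q (Suc n) = lambert_fps q n + (g - h)"
    by (simp add: lambert_fps_def g_def h_def)
  have "fps_deriv (theta_prod_fps q (Suc n)) * sinh_fps
      = (fps_deriv (theta_prod_fps q n) * sinh_fps) * (P * N) + theta_prod_fps q n * sinh_fps * (P * N) * (h - g)"
    unfolding F by (simp add: d algebra_simps)
  also have "\<dots> = (fps_deriv sinh_fps - sinh_fps * lambert_fps q (Suc n)) * theta_prod_fps q (Suc n)"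
    unfolding Suc.IH F L by (simp add: algebra_simps)
  finally show ?case .
qed

section \<open>Reciprocal q-Pochhammer symbols\<close>

text \<open>The reciprocal of (q; q)_m. The value 0 at negative arguments cuts off the finite theta
  sums and agrees with the recurrence.\<close>

definition inv_qpoch :: "complex \<Rightarrow> int \<Rightarrow> complex" where
  "inv_qpoch q m = (if m < 0 then 0 else 1 / (\<Prod>k=1..nat m. 1 - q ^ k))"

lemma one_minus_power_nonzero:
  fixes q :: complex
  assumes "norm q < 1" "k > 0"
  shows "1 - q ^ k \<noteq> 0"
proof
  assume "1 - q ^ k = 0"
  then have "norm (q ^ k) = 1"
    by simp
  moreover have "norm (q ^ k) < 1"
    using assms by (simp add: norm_power power_less_one_iff)
  ultimately show False by simp
qed

text \<open>At \<open>m = 0\<close> the factor \<open>1 - q powi m\<close> vanishes, which matches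
  the value 0 at -1; hence the recurrence holds for every integer \<open>m\<close>.\<close>

lemma inv_qpoch_rec:
  assumes "norm q < 1"
  shows "inv_qpoch q (m - 1) = (1 - q powi m) * inv_qpoch q m"
proof (cases "m \<le> 0")
  case True
  then show ?thesis by (cases "m = 0") (auto simp: inv_qpoch_def)
next
  case False
  define n where "n = nat (m - 1)"
  have m: "m = int (Suc n)"
    using False by (simp add: n_def)
  have "inv_qpoch q m = 1 / ((1 - q ^ Suc n) * (\<Prod>k=1..n. 1 - q ^ k))"
    unfolding m inv_qpoch_def nat_int by (simp add: mult.commute del: power_Suc)
  moreover have "inv_qpoch q (m - 1) = 1 / (\<Prod>k=1..n. 1 - q ^ k)"
    by (simp add: m inv_qpoch_def)
  moreover have "q powi m = q ^ Suc n"
    unfolding m by (rule power_int_of_nat)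
  ultimately show ?thesis
    using one_minus_power_nonzero[OF assms, of "Suc n"] by (simp del: power_Suc)
qed

text \<open>The infinite product of the \<open>1 - q ^ k\<close> converges absolutely and has no
  zero factor. The uniform bound \<open>C\<close> later supplies a dominating series.\<close>

lemma inv_qpoch_converges:
  fixes q :: complex
  assumes "norm q < 1"
  obtains L C where "(\<lambda>n. inv_qpoch q (int n)) \<longlonglongrightarrow> L" "L \<noteq> 0" "\<And>m. norm (inv_qpoch q m) \<le> C"
proof -
  define f where "f = (\<lambda>k. 1 - q ^ Suc k)"
  have "summable (\<lambda>k. norm (f k - 1))"
    using assms summable_geometric[of "norm q"] by (simp add: f_def norm_mult norm_power summable_mult)
  then have "abs_convergent_prod f"
    by (simp add: abs_convergent_prod_conv_summable)
  then have conv: "convergent_prod f"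
    by (rule abs_convergent_prod_imp_convergent_prod)
  have f0: "f k \<noteq> 0" for k
    unfolding f_def by (rule one_minus_power_nonzero[OF assms]) simp
  have "(\<lambda>n. \<Prod>i\<le>n. f i) \<longlonglongrightarrow> prodinf f"
    by (rule convergent_prod_LIMSEQ[OF conv])
  moreover have "(\<Prod>i\<le>n. f i) = (\<Prod>k=1..Suc n. 1 - q ^ k)" for n
    unfolding f_def by (rule prod.reindex_bij_witness[of _ "\<lambda>k. k - 1" Suc]) auto
  ultimately have "(\<lambda>n. 1 / (\<Prod>k=1..Suc n. 1 - q ^ k)) \<longlonglongrightarrow> 1 / prodinf f"
    using prodinf_nonzero[OF conv f0] by (intro tendsto_intros) auto
  then have "(\<lambda>n. inv_qpoch q (int (Suc n))) \<longlonglongrightarrow> 1 / prodinf f"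
    unfolding inv_qpoch_def nat_int by simp
  then have lim: "(\<lambda>n. inv_qpoch q (int n)) \<longlonglongrightarrow> 1 / prodinf f"
    by (rule LIMSEQ_imp_Suc)
  then obtain C where C: "\<And>n. norm (inv_qpoch q (int n)) \<le> C"
    using convergentI convergent_imp_Bseq BseqE by metis
  have bound: "norm (inv_qpoch q m) \<le> max C 0" for m
  proof (cases "m < 0")
    case False
    then show ?thesis
      using C[of "nat m"] by simp
  qed (simp add: inv_qpoch_def)
  show ?thesis
    using that[OF lim _ bound] prodinf_nonzero[OF conv f0] by simp
qed

section \<open>The finite triple product identity\<close>

text \<open>This is q itself, not its square root exp(pi i tau), for which the name is also in
  use.\<close>

definition nome :: "complex \<Rightarrow> complex" where
  "nome \<tau> = exp (2 * pi * \<i> * \<tau>)"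

lemma norm_nome_less_1: "Im \<tau> > 0 \<Longrightarrow> norm (nome \<tau>) < 1"
  by (simp add: nome_def)

text \<open>The exponents \<open>(j - 1/2)^2 / 2\<close> and \<open>(j + 1/2)^2 / 2\<close> of q
  differ by \<open>j\<close>, and the signs alternate.\<close>

lemma theta_term_pred:
  "theta_term 0 \<tau> 0 (j - 1) * nome \<tau> powi j = - theta_term 0 \<tau> 0 j"
proof -
  have "nome \<tau> powi j = exp (of_int j * (2 * pi * \<i> * \<tau>))"
    by (simp add: nome_def exp_power_int)
  moreover have "exp (pi * \<i> * \<tau> * (of_int (j - 1) + 1/2)\<^sup>2) * exp (of_int j * (2 * pi * \<i> * \<tau>))
      = exp (pi * \<i> * \<tau> * (of_int j + 1/2)\<^sup>2)"
    by (simp flip: exp_add) (rule arg_cong[where f = exp], simp add: field_simps power2_eq_square)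
  moreover have "(-1) powi (j - 1) = - ((-1) powi j :: complex)"
    by (auto simp: power_int_minus_left)
  ultimately show ?thesis
    by (simp add: theta_term_def)
qed

text \<open>Up to the constant (q; q)_(2n+1), the two reciprocal symbols form the q-binomial
  coefficient of \<open>2 * n + 1\<close> over \<open>n - j\<close>.\<close>

definition finite_theta_coeff :: "complex \<Rightarrow> nat \<Rightarrow> int \<Rightarrow> complex" where
  "finite_theta_coeff \<tau> n j = theta_term 0 \<tau> 0 j * inv_qpoch (nome \<tau>) (int n + 1 + j) * inv_qpoch (nome \<tau>) (int n - j)"

definition finite_theta_fps :: "complex \<Rightarrow> nat \<Rightarrow> complex fps" where
  "finite_theta_fps \<tau> n = (\<Sum>j=-int n-1..int n. fps_const (finite_theta_coeff \<tau> n j) * fps_exp (of_int j + 1/2))"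

lemma finite_theta_coeff_eq_0: "j \<notin> {-int n-1..int n} \<Longrightarrow> finite_theta_coeff \<tau> n j = 0"
  by (auto simp: finite_theta_coeff_def inv_qpoch_def)

lemma finite_theta_fps_eq_sum:
  assumes "finite S" "{-int n-1..int n} \<subseteq> S"
  shows "finite_theta_fps \<tau> n = (\<Sum>j\<in>S. fps_const (finite_theta_coeff \<tau> n j) * fps_exp (of_int j + 1/2))"
  unfolding finite_theta_fps_def using assms finite_theta_coeff_eq_0
  by (intro sum.mono_neutral_left) auto

text \<open>This is the coefficient form of multiplication by
  \<open>(1 - q^(n+1) * zeta) * (1 - q^(n+1) / zeta)\<close>, which equals
  \<open>1 + q^(2*n+2) - q^(n+1) * (zeta + 1 / zeta)\<close>.\<close>

lemma finite_theta_coeff_Suc: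
  assumes "Im \<tau> > 0"
  defines "q \<equiv> nome \<tau>"
  shows "(1 - q ^ (2 * n + 2)) * (1 - q ^ (2 * n + 3)) * finite_theta_coeff \<tau> (Suc n) j
    = (1 + q ^ (2 * n + 2)) * finite_theta_coeff \<tau> n j
      - q ^ Suc n * (finite_theta_coeff \<tau> n (j - 1) + finite_theta_coeff \<tau> n (j + 1))"
proof -
  have q1: "norm q < 1" and q0: "q \<noteq> 0"
    using norm_nome_less_1[OF assms(1)] by (auto simp: q_def nome_def)
  define u v where "u = q ^ n" and "v = q powi j"
  have v0: "v \<noteq> 0"
    using q0 by (simp add: v_def)
  \<comment> \<open>\<open>A\<close> and \<open>B\<close> carry the largest indices that occur, so
    the recurrence expresses every other symbol as a multiple of them without division.\<close>
  define A B t where "A = inv_qpoch q (int n + 2 + j)" and "B = inv_qpoch q (int n + 1 - j)" and "t = theta_term 0 \<tau> 0 j"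
  note rec = inv_qpoch_rec[OF q1]
  have pw: "q powi (int n + 2 + j) = u * v * q^2" "q powi (int n + 1 + j) = u * v * q"
    "q powi (int n + 1 - j) = u * q / v" "q powi (int n - j) = u / v"
    using q0 by (simp_all add: u_def v_def power_int_add power_int_diff)
  have A1: "inv_qpoch q (int n + 1 + j) = (1 - u * v * q^2) * A"
    using rec[of "int n + 2 + j"] unfolding pw by (simp add: A_def algebra_simps)
  have A2: "inv_qpoch q (int n + j) = (1 - u * v * q) * ((1 - u * v * q^2) * A)"
    using rec[of "int n + 1 + j"] unfolding A1 pw by (simp add: algebra_simps)
  have B1: "inv_qpoch q (int n - j) = (1 - u * q / v) * B"
    using rec[of "int n + 1 - j"] unfolding pw by (simp add: B_def algebra_simps)
  have B2: "inv_qpoch q (int n - 1 - j) = (1 - u / v) * ((1 - u * q / v) * B)"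
    using rec[of "int n - j"] unfolding B1 pw by (simp add: algebra_simps)
  have t1: "theta_term 0 \<tau> 0 (j - 1) = - t / v"
    using theta_term_pred[of \<tau> j] v0 by (simp add: t_def v_def q_def field_simps)
  have t2: "theta_term 0 \<tau> 0 (j + 1) = - t * (v * q)"
    using theta_term_pred[of \<tau> "j + 1"] q0
    by (simp add: t_def v_def q_def power_int_add)
  have c0: "finite_theta_coeff \<tau> (Suc n) j = t * A * B"
    unfolding finite_theta_coeff_def A_def B_def t_def q_def by (simp add: algebra_simps)
  have c1: "finite_theta_coeff \<tau> n j = t * ((1 - u * v * q^2) * A) * ((1 - u * q / v) * B)"
    unfolding finite_theta_coeff_def t_def q_def[symmetric] A1 B1 ..
  have c2: "finite_theta_coeff \<tau> n (j - 1) = (- t / v) * ((1 - u * v * q) * ((1 - u * v * q^2) * A)) * B"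
    unfolding finite_theta_coeff_def t1 q_def[symmetric] A2[symmetric] B_def by (simp add: algebra_simps)
  have c3: "finite_theta_coeff \<tau> n (j + 1) = (- t * (v * q)) * A * ((1 - u / v) * ((1 - u * q / v) * B))"
    unfolding finite_theta_coeff_def t2 q_def[symmetric] B2[symmetric] A_def by (simp add: algebra_simps)
  \<comment> \<open>What remains after removing the common factor \<open>t * A * B\<close> is a
    rational identity in \<open>q\<close>, \<open>u\<close> and \<open>v\<close>.\<close>
  have "(1 - u^2 * q^2) * (1 - u^2 * q^3) = (1 + u^2 * q^2) * ((1 - u * v * q^2) * (1 - u * q / v))
     - (u * q) * ((- 1 / v) * ((1 - u * v * q) * (1 - u * v * q^2)) + (- (v * q)) * ((1 - u / v) * (1 - u * q / v)))"
    using v0 by (simp add: field_simps) algebra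
  then have "(1 - u^2 * q^2) * (1 - u^2 * q^3) * (t * A * B) = ((1 + u^2 * q^2) * ((1 - u * v * q^2) * (1 - u * q / v))
     - (u * q) * ((- 1 / v) * ((1 - u * v * q) * (1 - u * v * q^2)) + (- (v * q)) * ((1 - u / v) * (1 - u * q / v)))) * (t * A * B)"
    by simp
  also have "\<dots> = (1 + u^2 * q^2) * finite_theta_coeff \<tau> n j
      - (u * q) * (finite_theta_coeff \<tau> n (j - 1) + finite_theta_coeff \<tau> n (j + 1))"
    unfolding c1 c2 c3 by algebra
  finally have "(1 - u^2 * q^2) * (1 - u^2 * q^3) * (t * A * B) = (1 + u^2 * q^2) * finite_theta_coeff \<tau> n j
      - (u * q) * (finite_theta_coeff \<tau> n (j - 1) + finite_theta_coeff \<tau> n (j + 1))" .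
  moreover have "q ^ (2 * n + 2) = u^2 * q^2" "q ^ (2 * n + 3) = u^2 * q^3" "q ^ Suc n = u * q"
    by (simp_all only: u_def power_add power_mult[symmetric] mult.commute[of n 2] power_Suc2)
  ultimately show ?thesis
    by (simp only: c0)
qed

lemma finite_theta_fps_Suc:
  assumes "Im \<tau> > 0"
  defines "q \<equiv> nome \<tau>"
  shows "fps_const ((1 - q ^ (2 * n + 2)) * (1 - q ^ (2 * n + 3))) * finite_theta_fps \<tau> (Suc n)
    = finite_theta_fps \<tau> n * ((1 - fps_const (q ^ Suc n) * fps_exp 1) * (1 - fps_const (q ^ Suc n) * fps_exp (-1)))"
proof -
  define e where "e = (\<lambda>j::int. fps_exp (of_int j + 1/2 :: complex))"
  define \<alpha> where "\<alpha> = finite_theta_coeff \<tau> n"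
  \<comment> \<open>The summation range for \<open>Suc n\<close>; it also contains the range for
    \<open>n\<close> and its shifts by one in either direction.\<close>
  define S where "S = {-int n-2..int n+1}"
  define c where "c = fps_const (q ^ Suc n)"
  have e1: "e j * fps_exp 1 = e (j + 1)" "e j * fps_exp (-1) = e (j - 1)" for j
    by (simp_all add: e_def fps_exp_add_mult[symmetric] algebra_simps)
  have T0: "finite_theta_fps \<tau> n = (\<Sum>j\<in>S. fps_const (\<alpha> j) * e j)"
    unfolding \<alpha>_def e_def S_def by (rule finite_theta_fps_eq_sum) auto
  \<comment> \<open>The sum is first padded with zero coefficients so that the shift maps its range
    exactly onto \<open>S\<close>.\<close>
  have "finite_theta_fps \<tau> n * fps_exp 1 = (\<Sum>j\<in>{-int n-3..int n}. fps_const (\<alpha> j) * e (j + 1))"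
    unfolding finite_theta_fps_eq_sum[of "{-int n-3..int n}" n, simplified] \<alpha>_def e1[symmetric]
    by (simp add: sum_distrib_right e_def mult.assoc)
  also have "\<dots> = (\<Sum>j\<in>S. fps_const (\<alpha> (j - 1)) * e j)"
    unfolding S_def by (rule sum.reindex_bij_witness[of _ "\<lambda>j. j - 1" "\<lambda>j. j + 1"]) auto
  finally have T1: "finite_theta_fps \<tau> n * fps_exp 1 = (\<Sum>j\<in>S. fps_const (\<alpha> (j - 1)) * e j)" .
  have "finite_theta_fps \<tau> n * fps_exp (-1) = (\<Sum>j\<in>{-int n-1..int n+2}. fps_const (\<alpha> j) * e (j - 1))"
    unfolding finite_theta_fps_eq_sum[of "{-int n-1..int n+2}" n, simplified] \<alpha>_def e1[symmetric]
    by (simp add: sum_distrib_right e_def mult.assoc)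
  also have "\<dots> = (\<Sum>j\<in>S. fps_const (\<alpha> (j + 1)) * e j)"
    unfolding S_def by (rule sum.reindex_bij_witness[of _ "\<lambda>j. j + 1" "\<lambda>j. j - 1"]) auto
  finally have T2: "finite_theta_fps \<tau> n * fps_exp (-1) = (\<Sum>j\<in>S. fps_const (\<alpha> (j + 1)) * e j)" .
  have "fps_exp 1 * fps_exp (-1 :: complex) = 1"
    by (simp flip: fps_exp_add_mult)
  then have P: "(1 - c * fps_exp 1) * (1 - c * fps_exp (-1)) = 1 + c * c - c * fps_exp 1 - c * fps_exp (-1)"
    by algebra
  have "finite_theta_fps \<tau> n * ((1 - c * fps_exp 1) * (1 - c * fps_exp (-1)))
      = (1 + c * c) * finite_theta_fps \<tau> n - c * (finite_theta_fps \<tau> n * fps_exp 1)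
        - c * (finite_theta_fps \<tau> n * fps_exp (-1))"
    unfolding P by (simp add: algebra_simps)
  also have "\<dots> = (\<Sum>j\<in>S. (1 + c * c) * (fps_const (\<alpha> j) * e j) - c * (fps_const (\<alpha> (j - 1)) * e j) - c * (fps_const (\<alpha> (j + 1)) * e j))"
    unfolding T1 T2 by (subst T0) (simp only: sum_distrib_left sum_subtractf)
  also have "\<dots> = (\<Sum>j\<in>S. fps_const ((1 - q ^ (2 * n + 2)) * (1 - q ^ (2 * n + 3)))
      * (fps_const (finite_theta_coeff \<tau> (Suc n) j) * e j))"
  proof (rule sum.cong[OF refl])
    fix j
    have "q ^ Suc n * q ^ Suc n = q ^ (2 * n + 2)"
      by (simp flip: power_add add: mult_2)
    then have cc: "1 + c * c = fps_const (1 + q ^ (2 * n + 2))"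
      unfolding c_def by (simp only: fps_const_mult fps_const_1_eq_1[symmetric] fps_const_add)
    have "(1 + c * c) * (fps_const (\<alpha> j) * e j) - c * (fps_const (\<alpha> (j - 1)) * e j) - c * (fps_const (\<alpha> (j + 1)) * e j)
      = ((1 + c * c) * fps_const (\<alpha> j) - c * (fps_const (\<alpha> (j - 1)) + fps_const (\<alpha> (j + 1)))) * e j"
      by (simp only: algebra_simps)
    also have "(1 + c * c) * fps_const (\<alpha> j) - c * (fps_const (\<alpha> (j - 1)) + fps_const (\<alpha> (j + 1)))
        = fps_const ((1 + q ^ (2 * n + 2)) * \<alpha> j - q ^ Suc n * (\<alpha> (j - 1) + \<alpha> (j + 1)))"
      unfolding cc by (simp only: c_def fps_const_mult fps_const_add fps_const_sub)
    also have "\<dots> = fps_const ((1 - q ^ (2 * n + 2)) * (1 - q ^ (2 * n + 3))) * fps_const (finite_theta_coeff \<tau> (Suc n) j)"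
      unfolding \<alpha>_def q_def by (simp only: finite_theta_coeff_Suc[OF assms(1)] fps_const_mult)
    finally show "(1 + c * c) * (fps_const (\<alpha> j) * e j) - c * (fps_const (\<alpha> (j - 1)) * e j) - c * (fps_const (\<alpha> (j + 1)) * e j)
      = fps_const ((1 - q ^ (2 * n + 2)) * (1 - q ^ (2 * n + 3))) * (fps_const (finite_theta_coeff \<tau> (Suc n) j) * e j)"
      by (simp only: mult.assoc)
  qed
  also have "\<dots> = fps_const ((1 - q ^ (2 * n + 2)) * (1 - q ^ (2 * n + 3))) * finite_theta_fps \<tau> (Suc n)"
    using finite_theta_fps_eq_sum[of S "Suc n" \<tau>] by (simp add: S_def e_def sum_distrib_left)
  finally show ?thesis
    unfolding c_def by simp
qed

text \<open>Jacobi's triple product in finite form, by induction on \<open>n\<close>: both sides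
  acquire the same two factors, and the recurrence of \<open>inv_qpoch\<close> matches the
  constants.\<close>

lemma finite_theta_fps_eq_prod:
  assumes "Im \<tau> > 0"
  shows "finite_theta_fps \<tau> n = fps_const (theta_term 0 \<tau> 0 0 * inv_qpoch (nome \<tau>) (2 * int n + 1)) * theta_prod_fps (nome \<tau>) n"
proof (induction n)
  case 0
  have "{- 1..0::int} = {-1, 0}"
    by auto
  moreover have "theta_term 0 \<tau> 0 (-1) = - theta_term 0 \<tau> 0 0"
    using theta_term_pred[of \<tau> 0] by simp
  moreover have "inv_qpoch q 0 = 1" for q
    by (simp add: inv_qpoch_def)
  ultimately show ?case
    by (simp add: finite_theta_fps_def finite_theta_coeff_def theta_prod_fps_def sinh_fps_def right_diff_distrib
        flip: fps_const_neg)
next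
  case (Suc n)
  define q \<gamma> where "q = nome \<tau>" and "\<gamma> = theta_term 0 \<tau> 0 0"
  have q: "norm q < 1"
    using norm_nome_less_1[OF assms] by (simp add: q_def)
  \<comment> \<open>The quotient of the values of \<open>inv_qpoch\<close> at
    \<open>2 * n + 1\<close> and \<open>2 * n + 3\<close>, from two steps of the recurrence.\<close>
  define d where "d = (1 - q ^ (2 * n + 2)) * (1 - q ^ (2 * n + 3))"
  have d0: "d \<noteq> 0"
    unfolding d_def using one_minus_power_nonzero[OF q, of "2 * n + 2"] one_minus_power_nonzero[OF q, of "2 * n + 3"] by auto
  have pw: "q powi (2 * int n + 2) = q ^ (2 * n + 2)" "q powi (2 * int n + 3) = q ^ (2 * n + 3)"
    by (simp_all add: add.commute flip: power_int_of_nat)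
  have h: "inv_qpoch q (2 * int n + 1) = d * inv_qpoch q (2 * int (Suc n) + 1)"
    using inv_qpoch_rec[OF q, of "2 * int n + 2"] inv_qpoch_rec[OF q, of "2 * int n + 3"]
    unfolding pw d_def by (simp add: add.commute del: power_Suc)
  have "fps_const d * finite_theta_fps \<tau> (Suc n)
      = fps_const (\<gamma> * inv_qpoch q (2 * int n + 1)) * theta_prod_fps q (Suc n)"
    unfolding d_def q_def finite_theta_fps_Suc[OF assms] Suc.IH
    by (simp only: \<gamma>_def theta_prod_fps_def prod.cl_ivl_Suc mult.assoc) simp
  also have "\<dots> = fps_const d * (fps_const (\<gamma> * inv_qpoch q (2 * int (Suc n) + 1)) * theta_prod_fps q (Suc n))"
    unfolding h by (simp only: fps_const_mult[symmetric] mult_ac)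
  finally have "finite_theta_fps \<tau> (Suc n) = fps_const (\<gamma> * inv_qpoch q (2 * int (Suc n) + 1)) * theta_prod_fps q (Suc n)"
    by (rule mult_left_cancel[THEN iffD1, rotated]) (simp add: d0)
  then show ?case
    by (simp only: q_def \<gamma>_def)
qed

section \<open>Passage to the limit in the finite identity\<close>

lemma theta_term_eq: "theta_term k \<tau> z j = theta_term 0 \<tau> z j * (of_int j + 1/2) ^ k"
  by (simp add: theta_term_def)

text \<open>Letting the sum run over all integers makes its range independent of \<open>n\<close>,
  as dominated convergence requires.\<close>

lemma finite_theta_fps_nth:
  "finite_theta_fps \<tau> n $ k = (\<Sum>\<^sub>\<infinity>j. theta_term k \<tau> 0 j * inv_qpoch (nome \<tau>) (int n + 1 + j) * inv_qpoch (nome \<tau>) (int n - j)) / fact k"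
proof -
  have "finite_theta_fps \<tau> n $ k = (\<Sum>j=-int n-1..int n. finite_theta_coeff \<tau> n j * (of_int j + 1/2) ^ k) / fact k"
    unfolding finite_theta_fps_def fps_sum_nth sum_divide_distrib by simp
  also have "(\<Sum>j=-int n-1..int n. finite_theta_coeff \<tau> n j * (of_int j + 1/2) ^ k)
      = (\<Sum>\<^sub>\<infinity>j\<in>{-int n-1..int n}. finite_theta_coeff \<tau> n j * (of_int j + 1/2) ^ k)"
    by simp
  also have "\<dots> = (\<Sum>\<^sub>\<infinity>j. finite_theta_coeff \<tau> n j * (of_int j + 1/2) ^ k)"
    by (rule infsum_cong_neutral) (use finite_theta_coeff_eq_0[of _ n \<tau>] in auto)
  finally show ?thesis
    by (simp add: finite_theta_coeff_def theta_term_eq[of k] mult_ac)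
qed

text \<open>Tannery's theorem: both reciprocal symbols tend to \<open>L\<close> for fixed
  \<open>j\<close>, and the terms are dominated by \<open>C\<^sup>2\<close> times those of the theta
  moment.\<close>

lemma finite_theta_fps_tendsto:
  assumes "Im \<tau> > 0"
    and L: "(\<lambda>n. inv_qpoch (nome \<tau>) (int n)) \<longlonglongrightarrow> L"
    and C: "\<And>m. norm (inv_qpoch (nome \<tau>) m) \<le> C"
  shows "(\<lambda>n. finite_theta_fps \<tau> n $ k) \<longlonglongrightarrow> L\<^sup>2 * theta_moment k \<tau> 0 / fact k"
proof -
  define h where "h = inv_qpoch (nome \<tau>)"
  define f where "f = (\<lambda>j n. theta_term k \<tau> 0 j * h (int n + 1 + j) * h (int n - j))"
  note summ = theta_term_abs_summable[OF assms(1), of k 0]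
  have lim_shift: "(\<lambda>n. h (int n + c)) \<longlonglongrightarrow> L" for c
  proof -
    have "filterlim (\<lambda>n. nat (int n + c)) sequentially sequentially"
      unfolding filterlim_at_top eventually_sequentially
    proof
      fix Z :: nat
      show "\<exists>N. \<forall>n\<ge>N. Z \<le> nat (int n + c)"
        by (rule exI[of _ "nat (int Z - c)"]) auto
    qed
    from filterlim_compose[OF L this]
    show ?thesis
    proof (rule Lim_transform_eventually)
      show "\<forall>\<^sub>F n in sequentially. inv_qpoch (nome \<tau>) (int (nat (int n + c))) = h (int n + c)"
        using eventually_ge_at_top[of "nat (- c)"] by eventually_elim (auto simp: h_def)
    qed
  qed
  have lim: "(\<lambda>n. f j n) \<longlonglongrightarrow> theta_term k \<tau> 0 j * L * L" for j
    unfolding f_def using lim_shift[of "1 + j"] lim_shift[of "- j"]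
    by (intro tendsto_intros) (simp_all add: add.assoc)
  have le: "norm (f j n) \<le> C\<^sup>2 * norm (theta_term k \<tau> 0 j)" for j n
  proof -
    have "norm (h (int n + 1 + j)) * norm (h (int n - j)) \<le> C * C"
      unfolding h_def by (intro mult_mono C order_trans[OF norm_ge_zero C]) auto
    from mult_left_mono[OF this norm_ge_zero[of "theta_term k \<tau> 0 j"]]
    show ?thesis
      by (simp add: f_def norm_mult power2_eq_square mult_ac)
  qed
  have fs: "(\<lambda>j. norm (f j n)) summable_on UNIV" for n
    by (rule Infinite_Sum.abs_summable_on_comparison_test'[OF summable_on_cmult_right[OF summ] le])
  have "((\<lambda>n. \<Sum>i. f (int_decode i) n) \<longlonglongrightarrow> (\<Sum>i. theta_term k \<tau> 0 (int_decode i) * L * L))"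
  proof (rule tannerys_theorem[THEN conjunct2, THEN conjunct2])
    show "summable (\<lambda>i. C\<^sup>2 * norm (theta_term k \<tau> 0 (int_decode i)))"
      by (intro summable_mult infsum_int_eq_suminf(2) summ)
    show "\<forall>\<^sub>F (i, n) in sequentially \<times>\<^sub>F sequentially.
        norm (f (int_decode i) n) \<le> C\<^sup>2 * norm (theta_term k \<tau> 0 (int_decode i))"
      using le by (intro always_eventually) auto
  qed (use lim in auto)
  also have "(\<lambda>n. \<Sum>i. f (int_decode i) n) = (\<lambda>n. \<Sum>\<^sub>\<infinity>j. f j n)"
    using infsum_int_eq_suminf(1)[OF fs] by simp
  also have "(\<Sum>i. theta_term k \<tau> 0 (int_decode i) * L * L) = (\<Sum>i. theta_term k \<tau> 0 (int_decode i)) * L * L"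
    using summable_norm_cancel[OF infsum_int_eq_suminf(2)[OF summ]]
    by (simp add: suminf_mult2[symmetric] summable_mult2)
  also have "(\<Sum>i. theta_term k \<tau> 0 (int_decode i)) = theta_moment k \<tau> 0"
    unfolding theta_moment_def using infsum_int_eq_suminf(1)[OF summ] by simp
  finally have "(\<lambda>n. (\<Sum>\<^sub>\<infinity>j. f j n) / fact k) \<longlonglongrightarrow> theta_moment k \<tau> 0 * L * L / fact k"
    by (intro tendsto_intros) auto
  then show ?thesis
    unfolding finite_theta_fps_nth by (simp add: f_def h_def power2_eq_square mult_ac)
qed

section \<open>Lambert series and divisor sums\<close>

text \<open>The double series over \<open>q ^ (k * d) * d ^ j\<close> with
  \<open>k, d \<ge> 1\<close> converges absolutely; grouping its terms by the product
  \<open>n = k * d\<close> makes \<open>d\<close> run through the divisors of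
  \<open>n\<close>.\<close>

lemma lambert_series_sums:
  fixes q :: complex
  assumes "norm q < 1"
  shows "(\<lambda>k. \<Sum>d. (q ^ Suc k) ^ Suc d * of_nat (Suc d) ^ j) sums (\<Sum>n. of_nat (divsum j (Suc n)) * q ^ Suc n)"
proof -
  define f where "f = (\<lambda>k d. (q ^ Suc k) ^ Suc d * of_nat (Suc d) ^ j :: complex)"
  define r where "r = norm q"
  have r: "0 \<le> r" "r < 1"
    using assms by (auto simp: r_def)
  have "summable (\<lambda>d. r ^ d * real d ^ j)"
    using r by (rule summable_power_mult_geometric)
  then have "summable (\<lambda>d. r ^ Suc d * real (Suc d) ^ j)"
    by (subst summable_Suc_iff)
  then have B: "(\<lambda>d. r ^ Suc d * real (Suc d) ^ j) summable_on UNIV"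
    using r by (intro norm_summable_imp_summable_on) simp
  have A: "(\<lambda>k. r ^ k) summable_on UNIV"
    using r by (intro norm_summable_imp_summable_on) (simp add: summable_geometric)
  have "(\<lambda>(k, d). r ^ k * (r ^ Suc d * real (Suc d) ^ j)) summable_on UNIV \<times> UNIV"
  proof (rule summable_on_SigmaI)
    show "((\<lambda>d. case (k, d) of (k, d) \<Rightarrow> r ^ k * (r ^ Suc d * real (Suc d) ^ j)) has_sum
        r ^ k * infsum (\<lambda>d. r ^ Suc d * real (Suc d) ^ j) UNIV) UNIV" for k
      unfolding prod.case by (intro has_sum_cmult_right has_sum_infsum B)
    show "(\<lambda>k. r ^ k * infsum (\<lambda>d. r ^ Suc d * real (Suc d) ^ j) UNIV) summable_on UNIV"
      by (intro summable_on_cmult_left A)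
  qed (use r in auto)
  then have "(\<lambda>p. norm (case p of (k, d) \<Rightarrow> f k d)) summable_on UNIV \<times> UNIV"
  proof (rule Infinite_Sum.abs_summable_on_comparison_test', clarify)
    fix k d
    \<comment> \<open>Bounding the product in the exponent below by a sum gives a majorant that
      factors into a function of \<open>k\<close> and a function of \<open>d\<close>.\<close>
    have "k + Suc d \<le> Suc k * Suc d"
      by simp
    then have "r ^ (Suc k * Suc d) \<le> r ^ (k + Suc d)"
      using r by (intro power_decreasing) auto
    then have "r ^ (Suc k * Suc d) * real (Suc d) ^ j \<le> r ^ (k + Suc d) * real (Suc d) ^ j"
      by (intro mult_right_mono) auto
    moreover have "norm (f k d) = r ^ (Suc k * Suc d) * real (Suc d) ^ j"
      unfolding f_def r_def norm_mult norm_power norm_of_nat power_mult ..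
    moreover have "r ^ (k + Suc d) * real (Suc d) ^ j = r ^ k * (r ^ Suc d * real (Suc d) ^ j)"
      by (simp only: power_add mult.assoc)
    ultimately show "norm (f k d) \<le> r ^ k * (r ^ Suc d * real (Suc d) ^ j)"
      by (simp only:)
  qed
  then have summ: "(\<lambda>(k, d). f k d) summable_on UNIV \<times> UNIV"
    by (rule abs_summable_summable)
  define S where "S = (\<Sum>\<^sub>\<infinity>(k, d)\<in>UNIV \<times> UNIV. f k d)"
  have "((\<lambda>k. \<Sum>\<^sub>\<infinity>d. f k d) has_sum S) UNIV"
    using has_sum_infsum[OF summable_on_Sigma_banach[OF summ]] infsum_Sigma'_banach[OF summ]
    by (simp add: S_def)
  moreover have "(\<Sum>\<^sub>\<infinity>d. f k d) = (\<Sum>d. f k d)" for k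
    using has_sum_imp_sums[OF has_sum_infsum[OF summable_on_SigmaD1[OF summ UNIV_I]]] sums_unique by blast
  ultimately have 1: "(\<lambda>k. \<Sum>d. f k d) sums S"
    using has_sum_imp_sums by simp
  define D where "D = (\<lambda>n. {d. d dvd Suc n})"
  define g where "g = (\<lambda>n d. q ^ Suc n * of_nat d ^ j)"
  \<comment> \<open>Indices start at 0, so \<open>k\<close>, \<open>d\<close> and \<open>n\<close>
    encode positive integers one larger, while the divisor in the second component is the actual
    divisor.\<close>
  have bij: "bij_betw (\<lambda>(k, d). (Suc k * Suc d - 1, Suc d)) (UNIV \<times> UNIV) (Sigma UNIV D)"
  proof (rule bij_betwI[where g = "\<lambda>(n, d). (Suc n div d - 1, d - 1)"])
    show "(\<lambda>(n, d). (Suc n div d - 1, d - 1)) \<in> Sigma UNIV D \<rightarrow> UNIV \<times> UNIV"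
      by auto
    have prod: "Suc (Suc k * Suc d - 1) = Suc k * Suc d" for k d
      by simp
    then have "Suc d dvd Suc (Suc k * Suc d - 1)" for k d
      by (simp only: dvd_triv_right)
    then show "(\<lambda>(k, d). (Suc k * Suc d - 1, Suc d)) \<in> UNIV \<times> UNIV \<rightarrow> Sigma UNIV D"
      by (auto simp: D_def simp del: mult_Suc mult_Suc_right)
    fix p :: "nat \<times> nat"
    obtain k d where kd: "p = (k, d)"
      by (cases p)
    show "(\<lambda>(n, d). (Suc n div d - 1, d - 1)) ((\<lambda>(k, d). (Suc k * Suc d - 1, Suc d)) p) = p"
      unfolding kd prod.case by (simp only: prod nonzero_mult_div_cancel_right[of "Suc d"]) simp
  next
    fix p assume "p \<in> Sigma UNIV D"
    then obtain n d where p: "p = (n, d)" and "d dvd Suc n"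
      by (auto simp: D_def)
    then obtain c where c: "Suc n = d * c"
      by blast
    then have n: "d * c - 1 = n"
      by (metis diff_Suc_1)
    from c have "d > 0" "c > 0"
      by (auto intro: Nat.gr0I)
    then show "(\<lambda>(k, d). (Suc k * Suc d - 1, Suc d)) ((\<lambda>(n, d). (Suc n div d - 1, d - 1)) p) = p"
      unfolding p prod.case c using n by (simp add: mult.commute[of c])
  qed
  have fg: "(case p of (k, d) \<Rightarrow> f k d) = (\<lambda>(n, d). g n d) ((\<lambda>(k, d). (Suc k * Suc d - 1, Suc d)) p)" for p
    unfolding f_def g_def case_prod_unfold fst_conv snd_conv power_mult[symmetric] by (simp del: power_Suc)
  have "((\<lambda>(k, d). f k d) has_sum S) (UNIV \<times> UNIV)"
    unfolding S_def by (rule has_sum_infsum[OF summ])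
  then have g: "((\<lambda>(n, d). g n d) has_sum S) (Sigma UNIV D)"
    unfolding fg using has_sum_reindex_bij_betw[OF bij] by blast
  then have gs: "(\<lambda>(n, d). g n d) summable_on Sigma UNIV D" and gS: "(\<Sum>\<^sub>\<infinity>(n, d)\<in>Sigma UNIV D. g n d) = S"
    using has_sum_imp_summable infsumI by blast+
  have "((\<lambda>n. \<Sum>\<^sub>\<infinity>d\<in>D n. g n d) has_sum S) UNIV"
    using has_sum_infsum[OF summable_on_Sigma_banach[OF gs]] infsum_Sigma'_banach[OF gs]
    by (simp add: gS)
  moreover have "(\<Sum>\<^sub>\<infinity>d\<in>D n. g n d) = of_nat (divsum j (Suc n)) * q ^ Suc n" for n
  proof -
    have "finite (D n)"
      by (simp add: D_def)
    then show ?thesis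
      by (simp add: g_def divsum_def D_def sum_distrib_left mult.commute del: power_Suc)
  qed
  ultimately have "((\<lambda>n. of_nat (divsum j (Suc n)) * q ^ Suc n) has_sum S) UNIV"
    by (simp only:)
  then have "S = (\<Sum>n. of_nat (divsum j (Suc n)) * q ^ Suc n)"
    by (rule sums_unique[OF has_sum_imp_sums])
  then show ?thesis
    using 1 by (simp only: f_def)
qed

definition divisor_series :: "nat \<Rightarrow> complex \<Rightarrow> complex" where
  "divisor_series j \<tau> = (\<Sum>n. of_nat (divsum j (Suc n)) * qexp \<tau> (Suc n))"

text \<open>The contributions of zeta and 1/zeta differ by the sign \<open>(-1) ^ j\<close>, so only
  odd \<open>j\<close> survive; these yield the divisor sums of the Eisenstein series.\<close>

lemma lambert_fps_tendsto:
  assumes "Im \<tau> > 0"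
  shows "(\<lambda>n. lambert_fps (nome \<tau>) n $ j) \<longlonglongrightarrow> (1 - (-1) ^ j) * divisor_series j \<tau> / fact j"
proof -
  define q where "q = nome \<tau>"
  have q: "norm q < 1"
    using norm_nome_less_1[OF assms] by (simp add: q_def)
  have qexp: "qexp \<tau> n = q ^ n" for n
    by (simp add: qexp_def q_def nome_def mult.commute flip: exp_of_nat_mult)
  define c where "c = (1 - (-1) ^ j) / (fact j :: complex)"
  have coeff: "(geom_fps 1 (q ^ Suc k) - geom_fps (-1) (q ^ Suc k)) $ j = c * (\<Sum>d. (q ^ Suc k) ^ Suc d * of_nat (Suc d) ^ j)" for k
  proof -
    have qk: "norm (q ^ Suc k) < 1"
      using q by (simp add: norm_power power_less_one_iff del: power_Suc)
    have *: "(\<Sum>d. (q ^ Suc k) ^ Suc d * (s * of_nat (Suc d)) ^ j) = s ^ j * (\<Sum>d. (q ^ Suc k) ^ Suc d * of_nat (Suc d) ^ j)" for s :: complex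
      using summable_geom_fps[OF qk, of 1 j]
      by (subst suminf_mult[symmetric]) (simp_all add: power_mult_distrib mult_ac)
    show ?thesis
      unfolding geom_fps_def fps_sub_nth fps_nth_Abs_fps * c_def by (simp add: algebra_simps diff_divide_distrib)
  qed
  have "lambert_fps q n $ j = (\<Sum>k<n. c * (\<Sum>d. (q ^ Suc k) ^ Suc d * of_nat (Suc d) ^ j))" for n
    unfolding lambert_fps_def fps_sum_nth coeff[symmetric]
    by (rule sum.reindex_bij_witness[of _ Suc "\<lambda>k. k - 1"]) auto
  moreover have "(\<lambda>n. \<Sum>k<n. c * (\<Sum>d. (q ^ Suc k) ^ Suc d * of_nat (Suc d) ^ j)) \<longlonglongrightarrow> c * divisor_series j \<tau>"
    using sums_mult[OF lambert_series_sums[OF q, of j], of c] by (simp add: sums_def divisor_series_def qexp)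
  ultimately show ?thesis
    by (simp add: q_def c_def)
qed

section \<open>Theta moments at \<open>z = 0\<close> in terms of Eisenstein series\<close>

text \<open>\<open>\<Theta>\<close> is the Taylor series of theta in u. The logarithmic derivative
  of the finite product passes to the limit, where the constant \<open>L\<^sup>2\<close> cancels;
  the linear coefficient of the product gives the nonvanishing.\<close>

lemma theta_fps_deriv:
  assumes "Im \<tau> > 0"
  defines "\<Theta> \<equiv> Abs_fps (\<lambda>k. theta_moment k \<tau> 0 / fact k)"
    and "M \<equiv> Abs_fps (\<lambda>j. (1 - (-1) ^ j) * divisor_series j \<tau> / fact j)"
  shows "fps_deriv \<Theta> * sinh_fps = (fps_deriv sinh_fps - sinh_fps * M) * \<Theta>"
    and "theta_moment 1 \<tau> 0 \<noteq> 0"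
proof -
  define q where "q = nome \<tau>"
  have q: "norm q < 1"
    using norm_nome_less_1[OF assms(1)] by (simp add: q_def)
  obtain L C where L: "(\<lambda>n. inv_qpoch q (int n)) \<longlonglongrightarrow> L" "L \<noteq> 0" and C: "\<And>m. norm (inv_qpoch q m) \<le> C"
    using inv_qpoch_converges[OF q] by blast
  define T where "T = finite_theta_fps \<tau>"
  define l where "l = fps_const (L\<^sup>2)"
  have Tlim: "(\<lambda>n. T n $ k) \<longlonglongrightarrow> (l * \<Theta>) $ k" for k
    using finite_theta_fps_tendsto[OF assms(1) L(1)[unfolded q_def] C[unfolded q_def], of k]
    by (simp add: T_def l_def \<Theta>_def)
  have T'lim: "(\<lambda>n. fps_deriv (T n) $ k) \<longlonglongrightarrow> fps_deriv (l * \<Theta>) $ k" for k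
    unfolding fps_deriv_nth by (intro tendsto_intros Tlim)
  have Mlim: "(\<lambda>n. lambert_fps q n $ k) \<longlonglongrightarrow> M $ k" for k
    using lambert_fps_tendsto[OF assms(1), of k] by (simp add: q_def M_def)
  have fin: "fps_deriv (T n) * sinh_fps = (fps_deriv sinh_fps - sinh_fps * lambert_fps q n) * T n" for n
  proof -
    obtain c where c: "T n = fps_const c * theta_prod_fps q n"
      unfolding T_def q_def finite_theta_fps_eq_prod[OF assms(1)] by blast
    have "fps_deriv (T n) * sinh_fps = fps_const c * (fps_deriv (theta_prod_fps q n) * sinh_fps)"
      unfolding c by (simp add: mult.assoc)
    then show ?thesis
      unfolding theta_prod_fps_deriv[OF q] c by (simp add: mult_ac)
  qed
  have "fps_deriv (l * \<Theta>) * sinh_fps = (fps_deriv sinh_fps - sinh_fps * M) * (l * \<Theta>)"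
  proof (rule fps_ext)
    fix k
    have 1: "(\<lambda>n. (fps_deriv (T n) * sinh_fps) $ k) \<longlonglongrightarrow> (fps_deriv (l * \<Theta>) * sinh_fps) $ k"
      by (intro fps_mult_nth_tendsto T'lim tendsto_const)
    have "(\<lambda>n. (fps_deriv sinh_fps - sinh_fps * lambert_fps q n) $ i) \<longlonglongrightarrow> (fps_deriv sinh_fps - sinh_fps * M) $ i" for i
      unfolding fps_sub_nth by (intro tendsto_diff fps_mult_nth_tendsto Mlim tendsto_const)
    then have 2: "(\<lambda>n. ((fps_deriv sinh_fps - sinh_fps * lambert_fps q n) * T n) $ k)
        \<longlonglongrightarrow> ((fps_deriv sinh_fps - sinh_fps * M) * (l * \<Theta>)) $ k"
      by (intro fps_mult_nth_tendsto Tlim)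
    show "(fps_deriv (l * \<Theta>) * sinh_fps) $ k = ((fps_deriv sinh_fps - sinh_fps * M) * (l * \<Theta>)) $ k"
      using LIMSEQ_unique[OF 1] 2 by (simp only: fin)
  qed
  then have "l * (fps_deriv \<Theta> * sinh_fps) = l * ((fps_deriv sinh_fps - sinh_fps * M) * \<Theta>)"
    by (simp add: l_def mult_ac)
  moreover have "l \<noteq> 0"
    using L(2) by (simp add: l_def)
  ultimately show "fps_deriv \<Theta> * sinh_fps = (fps_deriv sinh_fps - sinh_fps * M) * \<Theta>"
    by (simp only: mult_cancel_left simp_thms)
  define \<gamma> where "\<gamma> = theta_term 0 \<tau> 0 0"
  have \<gamma>: "\<gamma> \<noteq> 0"
    by (simp add: \<gamma>_def theta_term_def)
  have inv0: "inv_qpoch q (int n) \<noteq> 0" for n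
    using one_minus_power_nonzero[OF q] by (simp add: inv_qpoch_def)
  \<comment> \<open>As \<open>sinh_fps\<close> starts with u, the linear coefficient of the product
    is the product of the constant terms of the other factors.\<close>
  have "T n $ 1 = \<gamma> * inv_qpoch q (2 * int n + 1) / (inv_qpoch q (int n))\<^sup>2" for n
  proof -
    have "sinh_fps $ 0 = 0" "sinh_fps $ 1 = 1"
      by (simp_all add: sinh_fps_def)
    moreover have "(\<Prod>k=1..n. (1 - fps_const (q ^ k) * fps_exp 1) * (1 - fps_const (q ^ k) * fps_exp (-1))) $ 0
        = (\<Prod>k=1..n. (1 - q ^ k) * (1 - q ^ k))"
      by (induction n) (simp_all add: fps_mult_nth)
    ultimately have "theta_prod_fps q n $ 1 = (\<Prod>k=1..n. 1 - q ^ k)\<^sup>2"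
      unfolding theta_prod_fps_def by (simp add: fps_mult_nth prod.distrib power2_eq_square)
    then show ?thesis
      unfolding T_def finite_theta_fps_eq_prod[OF assms(1)] q_def[symmetric]
      by (simp add: \<gamma>_def inv_qpoch_def power_divide)
  qed
  moreover have "(\<lambda>n. inv_qpoch q (2 * int n + 1)) \<longlonglongrightarrow> L"
    using LIMSEQ_subseq_LIMSEQ[OF L(1), of "\<lambda>n. 2 * n + 1"] by (simp add: strict_mono_def o_def add.commute)
  ultimately have "(\<lambda>n. T n $ 1) \<longlonglongrightarrow> \<gamma> * L / L\<^sup>2"
    using L by (simp only:) (intro tendsto_intros, auto)
  then have "(l * \<Theta>) $ 1 = \<gamma> * L / L\<^sup>2"
    using Tlim LIMSEQ_unique by blast
  then show "theta_moment 1 \<tau> 0 \<noteq> 0"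
    using \<gamma> L(2) by (auto simp: \<Theta>_def l_def)
qed

text \<open>The coefficients of u^3, u^5 and u^7 in the logarithmic derivative equation determine
  \<open>t 3\<close>, \<open>t 5\<close> and \<open>t 7\<close> successively from
  \<open>t 1\<close>.\<close>

lemma theta_moments_0:
  assumes "Im \<tau> > 0"
  defines "t \<equiv> \<lambda>k. theta_moment k \<tau> 0"
  shows "t 3 = t 1 * (E2 \<tau> / 4)"
    and "t 5 = t 1 * (5/48 * E2 \<tau> ^ 2 - E4 \<tau> / 24)"
    and "t 7 = t 1 * (35/576 * E2 \<tau> ^ 3 - 7/96 * E2 \<tau> * E4 \<tau> + E6 \<tau> / 36)"
proof -
  define \<Theta> where "\<Theta> = Abs_fps (\<lambda>k. t k / fact k)"
  define M where "M = Abs_fps (\<lambda>j. (1 - (-1) ^ j) * divisor_series j \<tau> / fact j)"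
  have D: "fps_deriv \<Theta> * sinh_fps = (fps_deriv sinh_fps - sinh_fps * M) * \<Theta>"
    unfolding \<Theta>_def M_def t_def by (rule theta_fps_deriv[OF assms(1)])
  have S: "divisor_series 1 \<tau> = (1 - E2 \<tau>) / 24" "divisor_series 3 \<tau> = (E4 \<tau> - 1) / 240" "divisor_series 5 \<tau> = (1 - E6 \<tau>) / 504"
    by (simp_all add: divisor_series_def E2_def E4_def E6_def)
  have T: "\<Theta> $ 0 = 0" "\<Theta> $ 1 = t 1" "\<Theta> $ 2 = 0" "\<Theta> $ 3 = t 3 / 6" "\<Theta> $ 4 = 0" "\<Theta> $ 5 = t 5 / 120" "\<Theta> $ 6 = 0" "\<Theta> $ 7 = t 7 / 5040"
    by (simp_all add: \<Theta>_def t_def theta_moment_even_0 fact_numeral)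
  have V: "sinh_fps $ 0 = 0" "sinh_fps $ 1 = 1" "sinh_fps $ 2 = 0" "sinh_fps $ 3 = 1/24" "sinh_fps $ 4 = 0" "sinh_fps $ 5 = 1/1920" "sinh_fps $ 6 = 0" "sinh_fps $ 7 = 1/322560"
    by (simp_all add: sinh_fps_def fact_numeral power_divide)
  have M: "M $ 0 = 0" "M $ 1 = (1 - E2 \<tau>) / 12" "M $ 2 = 0" "M $ 3 = (E4 \<tau> - 1) / 720" "M $ 4 = 0" "M $ 5 = (1 - E6 \<tau>) / 30240" "M $ 6 = 0"
    by (simp_all add: M_def S S(1)[unfolded One_nat_def] fact_numeral)
  have idx: "{0..7::nat} = {0, 1, 2, 3, 4, 5, 6, 7}" "{0..5::nat} = {0, 1, 2, 3, 4, 5}" "{0..3::nat} = {0, 1, 2, 3}"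
    "{0..6::nat} = {0, 1, 2, 3, 4, 5, 6}" "{0..4::nat} = {0, 1, 2, 3, 4}" "{0..2::nat} = {0, 1, 2}" "{0..1::nat} = {0, 1}"
    by auto
  note simps = fps_mult_nth fps_deriv_nth fps_sub_nth idx T V M
  have "(fps_deriv \<Theta> * sinh_fps) $ 3 = ((fps_deriv sinh_fps - sinh_fps * M) * \<Theta>) $ 3"
    by (simp only: D)
  then show t3: "t 3 = t 1 * (E2 \<tau> / 4)"
    by (simp add: simps T(2)[unfolded One_nat_def] V(2)[unfolded One_nat_def] M(2)[unfolded One_nat_def] field_simps)
  have "(fps_deriv \<Theta> * sinh_fps) $ 5 = ((fps_deriv sinh_fps - sinh_fps * M) * \<Theta>) $ 5"
    by (simp only: D)
  then show t5: "t 5 = t 1 * (5/48 * E2 \<tau> ^ 2 - E4 \<tau> / 24)"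
    by (simp add: simps T(2)[unfolded One_nat_def] V(2)[unfolded One_nat_def] M(2)[unfolded One_nat_def] t3 power2_eq_square field_simps) algebra
  have "(fps_deriv \<Theta> * sinh_fps) $ 7 = ((fps_deriv sinh_fps - sinh_fps * M) * \<Theta>) $ 7"
    by (simp only: D)
  then show "t 7 = t 1 * (35/576 * E2 \<tau> ^ 3 - 7/96 * E2 \<tau> * E4 \<tau> + E6 \<tau> / 36)"
    by (simp add: simps T(2)[unfolded One_nat_def] V(2)[unfolded One_nat_def] M(2)[unfolded One_nat_def] t3 t5 power2_eq_square power3_eq_cube field_simps) algebra
qed

section \<open>The modular differential equation\<close>

text \<open>On the open half-plane \<open>E2\<close> is \<open>4 * t 3 / t 1\<close>. By the heat
  equation its derivative involves only \<open>t 1\<close>, \<open>t 3\<close> and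
  \<open>t 5\<close>, which are known in terms of \<open>E2\<close> and \<open>E4\<close>.\<close>

lemma E2_has_field_derivative:
  assumes "Im \<tau> > 0"
  shows "(E2 has_field_derivative 2 * pi * \<i> * ((E2 \<tau> ^ 2 - E4 \<tau>) / 12)) (at \<tau>)"
proof -
  define t where "t = (\<lambda>k \<tau>. theta_moment k \<tau> 0)"
  have dt: "(t k has_field_derivative pi * \<i> * t (k + 2) \<tau>) (at \<tau>)" for k
    unfolding t_def by (rule theta_moment_has_field_derivative_tau[OF assms])
  have t1: "t 1 \<tau> \<noteq> 0" if "Im \<tau> > 0" for \<tau>
    unfolding t_def by (rule theta_fps_deriv(2)[OF that])
  have E2: "4 * t 3 \<tau> / t 1 \<tau> = E2 \<tau>" if "Im \<tau> > 0" for \<tau>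
    using theta_moments_0(1)[OF that] t1[OF that] by (simp add: t_def field_simps)
  have "((\<lambda>\<tau>. 4 * t 3 \<tau> / t 1 \<tau>) has_field_derivative
      (4 * (pi * \<i> * t 5 \<tau>) * t 1 \<tau> - 4 * t 3 \<tau> * (pi * \<i> * t 3 \<tau>)) / (t 1 \<tau> * t 1 \<tau>)) (at \<tau>)"
    using dt[of 1] dt[of 3] by (intro DERIV_divide DERIV_cmult t1 assms) (simp_all add: eval_nat_numeral)
  also have "(4 * (pi * \<i> * t 5 \<tau>) * t 1 \<tau> - 4 * t 3 \<tau> * (pi * \<i> * t 3 \<tau>)) / (t 1 \<tau> * t 1 \<tau>)
      = 2 * pi * \<i> * ((E2 \<tau> ^ 2 - E4 \<tau>) / 12)"
    using t1[OF assms] unfolding t_def theta_moments_0[OF assms]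
    by (simp add: field_simps power2_eq_square)
  finally show ?thesis
    by (rule has_field_derivative_transform_within_open[where S = "{\<tau>. Im \<tau> > 0}"])
       (use assms E2 in \<open>auto simp: open_halfspace_Im_gt\<close>)
qed

text \<open>The formula for \<open>t 5\<close> is solved for \<open>E4\<close>; differentiating it
  brings in \<open>t 7\<close> and thereby \<open>E6\<close>.\<close>

lemma E4_has_field_derivative:
  assumes "Im \<tau> > 0"
  shows "(E4 has_field_derivative 2 * pi * \<i> * ((E2 \<tau> * E4 \<tau> - E6 \<tau>) / 3)) (at \<tau>)"
proof -
  define t where "t = (\<lambda>k \<tau>. theta_moment k \<tau> 0)"
  have dt: "(t k has_field_derivative pi * \<i> * t (k + 2) \<tau>) (at \<tau>)" for k
    unfolding t_def by (rule theta_moment_has_field_derivative_tau[OF assms])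
  have t1: "t 1 \<tau> \<noteq> 0" if "Im \<tau> > 0" for \<tau>
    unfolding t_def by (rule theta_fps_deriv(2)[OF that])
  have E4: "5 / 2 * E2 \<tau> ^ 2 - 24 * t 5 \<tau> / t 1 \<tau> = E4 \<tau>" if "Im \<tau> > 0" for \<tau>
    using theta_moments_0(2)[OF that] t1[OF that] by (simp add: t_def field_simps)
  have dt1: "(t 1 has_field_derivative pi * \<i> * t 3 \<tau>) (at \<tau>)" and dt5: "(t 5 has_field_derivative pi * \<i> * t 7 \<tau>) (at \<tau>)"
    using dt[of 1] dt[of 5] by (simp_all add: numeral_3_eq_3)
  have "((\<lambda>\<tau>. 5 / 2 * E2 \<tau> ^ 2 - 24 * t 5 \<tau> / t 1 \<tau>) has_field_derivative
      5 / 2 * (2 * E2 \<tau> * (2 * pi * \<i> * ((E2 \<tau> ^ 2 - E4 \<tau>) / 12)))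
      - (24 * (pi * \<i> * t 7 \<tau>) * t 1 \<tau> - 24 * t 5 \<tau> * (pi * \<i> * t 3 \<tau>)) / (t 1 \<tau> * t 1 \<tau>)) (at \<tau>)"
    by (rule derivative_eq_intros E2_has_field_derivative[OF assms] dt1 dt5 refl t1[OF assms])+ (simp add: mult_ac)
  also have "5 / 2 * (2 * E2 \<tau> * (2 * pi * \<i> * ((E2 \<tau> ^ 2 - E4 \<tau>) / 12)))
      - (24 * (pi * \<i> * t 7 \<tau>) * t 1 \<tau> - 24 * t 5 \<tau> * (pi * \<i> * t 3 \<tau>)) / (t 1 \<tau> * t 1 \<tau>)
      = 2 * pi * \<i> * ((E2 \<tau> * E4 \<tau> - E6 \<tau>) / 3)"
    using t1[OF assms] unfolding t_def theta_moments_0[OF assms]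
    by (simp add: field_simps power2_eq_square power3_eq_cube)
  finally show ?thesis
    by (rule has_field_derivative_transform_within_open[where S = "{\<tau>. Im \<tau> > 0}"])
       (use assms E4 in \<open>auto simp: open_halfspace_Im_gt\<close>)
qed

section \<open>Polynomial relations between the theta moments at arbitrary \<open>z\<close>\<close>

lemma pred_small_numerals: "2 - Suc 0 = 1" "3 - Suc 0 = 2" "4 - Suc 0 = (3::nat)"
  by simp_all

lemma theta_moment_has_field_derivative_z_numeral:
  assumes "Im \<tau> > 0"
  shows "(theta_moment 0 \<tau> has_field_derivative 2 * pi * \<i> * theta_moment 1 \<tau> z) (at z)"
    and "(theta_moment 1 \<tau> has_field_derivative 2 * pi * \<i> * theta_moment 2 \<tau> z) (at z)"
    and "(theta_moment 2 \<tau> has_field_derivative 2 * pi * \<i> * theta_moment 3 \<tau> z) (at z)"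
    and "(theta_moment 3 \<tau> has_field_derivative 2 * pi * \<i> * theta_moment 4 \<tau> z) (at z)"
    and "(theta_moment 4 \<tau> has_field_derivative 2 * pi * \<i> * theta_moment 5 \<tau> z) (at z)"
    and "(theta_moment 5 \<tau> has_field_derivative 2 * pi * \<i> * theta_moment 6 \<tau> z) (at z)"
  using theta_moment_has_field_derivative_z[OF assms, of 0 z]
    theta_moment_has_field_derivative_z[OF assms, of 1 z]
    theta_moment_has_field_derivative_z[OF assms, of 2 z]
    theta_moment_has_field_derivative_z[OF assms, of 3 z]
    theta_moment_has_field_derivative_z[OF assms, of 4 z]
    theta_moment_has_field_derivative_z[OF assms, of 5 z]
  by (simp_all add: eval_nat_numeral)

text \<open>The halves expose the factor \<open>2 * pi * \<i>\<close> by which \<open>Dq\<close>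
  divides.\<close>

lemma theta_moment_has_field_derivative_tau_numeral:
  assumes "Im \<tau> > 0"
  shows "((\<lambda>\<tau>. theta_moment 0 \<tau> z) has_field_derivative 2 * pi * \<i> * (theta_moment 2 \<tau> z / 2)) (at \<tau>)"
    and "((\<lambda>\<tau>. theta_moment 1 \<tau> z) has_field_derivative 2 * pi * \<i> * (theta_moment 3 \<tau> z / 2)) (at \<tau>)"
    and "((\<lambda>\<tau>. theta_moment 2 \<tau> z) has_field_derivative 2 * pi * \<i> * (theta_moment 4 \<tau> z / 2)) (at \<tau>)"
  using theta_moment_has_field_derivative_tau[OF assms, of 0 z]
    theta_moment_has_field_derivative_tau[OF assms, of 1 z]
    theta_moment_has_field_derivative_tau[OF assms, of 2 z]
  by (simp_all add: eval_nat_numeral mult.assoc)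

text \<open>The first relation is the differential equation \<open>\<wp>'' = 6\<wp>\<^sup>2 - E\<^sub>4/24\<close> for
  \<open>\<wp> = E\<^sub>2/12 - (log \<theta>)''\<close>, multiplied by \<open>- \<theta>\<^sup>2\<close>; the next two are its derivatives.\<close>

lemma theta_relations:
  assumes "Im \<tau> > 0"
  shows "1/24 * theta_moment 0 \<tau> z ^ 2 * E2 \<tau> ^ 2
      - 1/24 * theta_moment 0 \<tau> z ^ 2 * E4 \<tau>
      - theta_moment 0 \<tau> z * theta_moment 2 \<tau> z * E2 \<tau>
      + theta_moment 0 \<tau> z * theta_moment 4 \<tau> z + theta_moment 1 \<tau> z ^ 2 * E2 \<tau>
      - 4 * theta_moment 1 \<tau> z * theta_moment 3 \<tau> z + 3 * theta_moment 2 \<tau> z ^ 2 = 0"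
    and "1/12 * theta_moment 0 \<tau> z * theta_moment 1 \<tau> z * E2 \<tau> ^ 2
      - 1/12 * theta_moment 0 \<tau> z * theta_moment 1 \<tau> z * E4 \<tau>
      - theta_moment 0 \<tau> z * theta_moment 3 \<tau> z * E2 \<tau>
      + theta_moment 0 \<tau> z * theta_moment 5 \<tau> z
      + theta_moment 1 \<tau> z * theta_moment 2 \<tau> z * E2 \<tau>
      - 3 * theta_moment 1 \<tau> z * theta_moment 4 \<tau> z
      + 2 * theta_moment 2 \<tau> z * theta_moment 3 \<tau> z = 0"
    and "1/12 * theta_moment 0 \<tau> z * theta_moment 2 \<tau> z * E2 \<tau> ^ 2
      - 1/12 * theta_moment 0 \<tau> z * theta_moment 2 \<tau> z * E4 \<tau>
      - theta_moment 0 \<tau> z * theta_moment 4 \<tau> z * E2 \<tau>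
      + theta_moment 0 \<tau> z * theta_moment 6 \<tau> z
      + 1/12 * theta_moment 1 \<tau> z ^ 2 * E2 \<tau> ^ 2
      - 1/12 * theta_moment 1 \<tau> z ^ 2 * E4 \<tau>
      - 2 * theta_moment 1 \<tau> z * theta_moment 5 \<tau> z
      + theta_moment 2 \<tau> z ^ 2 * E2 \<tau> - theta_moment 2 \<tau> z * theta_moment 4 \<tau> z
      + 2 * theta_moment 3 \<tau> z ^ 2 = 0"
    and "5/72 * theta_moment 0 \<tau> z ^ 2 * E2 \<tau> ^ 3
      - 1/8 * theta_moment 0 \<tau> z ^ 2 * E2 \<tau> * E4 \<tau>
      + 1/18 * theta_moment 0 \<tau> z ^ 2 * E6 \<tau>
      - 5/4 * theta_moment 0 \<tau> z * theta_moment 2 \<tau> z * E2 \<tau> ^ 2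
      + 1/4 * theta_moment 0 \<tau> z * theta_moment 2 \<tau> z * E4 \<tau>
      + theta_moment 0 \<tau> z * theta_moment 6 \<tau> z
      + 5/4 * theta_moment 1 \<tau> z ^ 2 * E2 \<tau> ^ 2
      - 1/4 * theta_moment 1 \<tau> z ^ 2 * E4 \<tau>
      - 6 * theta_moment 1 \<tau> z * theta_moment 5 \<tau> z
      + 15 * theta_moment 2 \<tau> z * theta_moment 4 \<tau> z - 10 * theta_moment 3 \<tau> z ^ 2 = 0"
proof -
  have t1: "theta_moment 1 \<tau> 0 \<noteq> 0"
    by (rule theta_fps_deriv(2)[OF assms])
  note t = theta_moments_0[OF assms]
  \<comment> \<open>With \<open>t 3\<close> and \<open>t 5\<close> inserted, every coefficient of
    the order 4 relation has the factor \<open>t 1 ^ 2\<close>, which cancels.\<close>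
  have "theta_moment 1 \<tau> 0 ^ 2 * hirota4 \<tau> z = theta_moment 1 \<tau> 0 ^ 2 *
      (E2 \<tau> * hirota2 \<tau> z - (E2 \<tau> ^ 2 - E4 \<tau>) / 24 * theta_moment 0 \<tau> z ^ 2)" for z
    unfolding hirota_relations(1)[OF assms] t by (simp add: field_simps power2_eq_square)
  then have X4: "hirota4 \<tau> z = E2 \<tau> * hirota2 \<tau> z - (E2 \<tau> ^ 2 - E4 \<tau>) / 24 * theta_moment 0 \<tau> z ^ 2" for z
    using t1 by (simp only: mult_cancel_left power_eq_0_iff) simp
  have R4: "1/24 * theta_moment 0 \<tau> z ^ 2 * E2 \<tau> ^ 2
      - 1/24 * theta_moment 0 \<tau> z ^ 2 * E4 \<tau>
      - theta_moment 0 \<tau> z * theta_moment 2 \<tau> z * E2 \<tau>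
      + theta_moment 0 \<tau> z * theta_moment 4 \<tau> z + theta_moment 1 \<tau> z ^ 2 * E2 \<tau>
      - 4 * theta_moment 1 \<tau> z * theta_moment 3 \<tau> z + 3 * theta_moment 2 \<tau> z ^ 2 = 0" for z
    using X4[of z] unfolding hirota4_def hirota2_def by algebra
  have "theta_moment 1 \<tau> 0 ^ 2 * hirota6 \<tau> z = theta_moment 1 \<tau> 0 ^ 2 *
      ((5/4 * E2 \<tau> ^ 2 - E4 \<tau> / 4) * hirota2 \<tau> z
        - (5/72 * E2 \<tau> ^ 3 - E2 \<tau> * E4 \<tau> / 8 + E6 \<tau> / 18) * theta_moment 0 \<tau> z ^ 2)"
    unfolding hirota_relations(2)[OF assms] t by (simp add: field_simps power2_eq_square power3_eq_cube)
  then have "hirota6 \<tau> z = (5/4 * E2 \<tau> ^ 2 - E4 \<tau> / 4) * hirota2 \<tau> z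
        - (5/72 * E2 \<tau> ^ 3 - E2 \<tau> * E4 \<tau> / 8 + E6 \<tau> / 18) * theta_moment 0 \<tau> z ^ 2"
    using t1 by (simp only: mult_cancel_left power_eq_0_iff) simp
  then show "5/72 * theta_moment 0 \<tau> z ^ 2 * E2 \<tau> ^ 3
      - 1/8 * theta_moment 0 \<tau> z ^ 2 * E2 \<tau> * E4 \<tau>
      + 1/18 * theta_moment 0 \<tau> z ^ 2 * E6 \<tau>
      - 5/4 * theta_moment 0 \<tau> z * theta_moment 2 \<tau> z * E2 \<tau> ^ 2
      + 1/4 * theta_moment 0 \<tau> z * theta_moment 2 \<tau> z * E4 \<tau>
      + theta_moment 0 \<tau> z * theta_moment 6 \<tau> z
      + 5/4 * theta_moment 1 \<tau> z ^ 2 * E2 \<tau> ^ 2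
      - 1/4 * theta_moment 1 \<tau> z ^ 2 * E4 \<tau>
      - 6 * theta_moment 1 \<tau> z * theta_moment 5 \<tau> z
      + 15 * theta_moment 2 \<tau> z * theta_moment 4 \<tau> z - 10 * theta_moment 3 \<tau> z ^ 2 = 0"
    unfolding hirota6_def hirota2_def by algebra
  note dz = theta_moment_has_field_derivative_z_numeral[OF assms]
  \<comment> \<open>A relation valid for all \<open>z\<close> is a constant function of
    \<open>z\<close>, so its formal derivative in the moments vanishes too.\<close>
  have zero: "p = 0" if "((\<lambda>_. 0) has_field_derivative 2 * pi * \<i> * p) (at z)" for p z :: complex
    using DERIV_unique[OF that DERIV_const] by simp
  have "((\<lambda>z. 1/24 * theta_moment 0 \<tau> z ^ 2 * E2 \<tau> ^ 2
      - 1/24 * theta_moment 0 \<tau> z ^ 2 * E4 \<tau>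
      - theta_moment 0 \<tau> z * theta_moment 2 \<tau> z * E2 \<tau>
      + theta_moment 0 \<tau> z * theta_moment 4 \<tau> z + theta_moment 1 \<tau> z ^ 2 * E2 \<tau>
      - 4 * theta_moment 1 \<tau> z * theta_moment 3 \<tau> z + 3 * theta_moment 2 \<tau> z ^ 2) has_field_derivative 2 * pi * \<i> *
     (1/12 * theta_moment 0 \<tau> z * theta_moment 1 \<tau> z * E2 \<tau> ^ 2
      - 1/12 * theta_moment 0 \<tau> z * theta_moment 1 \<tau> z * E4 \<tau>
      - theta_moment 0 \<tau> z * theta_moment 3 \<tau> z * E2 \<tau>
      + theta_moment 0 \<tau> z * theta_moment 5 \<tau> z
      + theta_moment 1 \<tau> z * theta_moment 2 \<tau> z * E2 \<tau>
      - 3 * theta_moment 1 \<tau> z * theta_moment 4 \<tau> z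
      + 2 * theta_moment 2 \<tau> z * theta_moment 3 \<tau> z)) (at z)" for z
    by (rule derivative_eq_intros dz refl)+ (simp only: of_nat_numeral pred_small_numerals power_one_right, algebra)
  then have R41: "1/12 * theta_moment 0 \<tau> z * theta_moment 1 \<tau> z * E2 \<tau> ^ 2
      - 1/12 * theta_moment 0 \<tau> z * theta_moment 1 \<tau> z * E4 \<tau>
      - theta_moment 0 \<tau> z * theta_moment 3 \<tau> z * E2 \<tau>
      + theta_moment 0 \<tau> z * theta_moment 5 \<tau> z
      + theta_moment 1 \<tau> z * theta_moment 2 \<tau> z * E2 \<tau>
      - 3 * theta_moment 1 \<tau> z * theta_moment 4 \<tau> z
      + 2 * theta_moment 2 \<tau> z * theta_moment 3 \<tau> z = 0" for z
    unfolding R4 by (rule zero)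
  have "((\<lambda>z. 1/12 * theta_moment 0 \<tau> z * theta_moment 1 \<tau> z * E2 \<tau> ^ 2
      - 1/12 * theta_moment 0 \<tau> z * theta_moment 1 \<tau> z * E4 \<tau>
      - theta_moment 0 \<tau> z * theta_moment 3 \<tau> z * E2 \<tau>
      + theta_moment 0 \<tau> z * theta_moment 5 \<tau> z
      + theta_moment 1 \<tau> z * theta_moment 2 \<tau> z * E2 \<tau>
      - 3 * theta_moment 1 \<tau> z * theta_moment 4 \<tau> z
      + 2 * theta_moment 2 \<tau> z * theta_moment 3 \<tau> z) has_field_derivative 2 * pi * \<i> *
     (1/12 * theta_moment 0 \<tau> z * theta_moment 2 \<tau> z * E2 \<tau> ^ 2
      - 1/12 * theta_moment 0 \<tau> z * theta_moment 2 \<tau> z * E4 \<tau>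
      - theta_moment 0 \<tau> z * theta_moment 4 \<tau> z * E2 \<tau>
      + theta_moment 0 \<tau> z * theta_moment 6 \<tau> z
      + 1/12 * theta_moment 1 \<tau> z ^ 2 * E2 \<tau> ^ 2
      - 1/12 * theta_moment 1 \<tau> z ^ 2 * E4 \<tau>
      - 2 * theta_moment 1 \<tau> z * theta_moment 5 \<tau> z
      + theta_moment 2 \<tau> z ^ 2 * E2 \<tau> - theta_moment 2 \<tau> z * theta_moment 4 \<tau> z
      + 2 * theta_moment 3 \<tau> z ^ 2)) (at z)"
    by (rule derivative_eq_intros dz refl)+ (simp only: of_nat_numeral pred_small_numerals power_one_right, algebra)
  then show "1/12 * theta_moment 0 \<tau> z * theta_moment 2 \<tau> z * E2 \<tau> ^ 2
      - 1/12 * theta_moment 0 \<tau> z * theta_moment 2 \<tau> z * E4 \<tau>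
      - theta_moment 0 \<tau> z * theta_moment 4 \<tau> z * E2 \<tau>
      + theta_moment 0 \<tau> z * theta_moment 6 \<tau> z
      + 1/12 * theta_moment 1 \<tau> z ^ 2 * E2 \<tau> ^ 2
      - 1/12 * theta_moment 1 \<tau> z ^ 2 * E4 \<tau>
      - 2 * theta_moment 1 \<tau> z * theta_moment 5 \<tau> z
      + theta_moment 2 \<tau> z ^ 2 * E2 \<tau> - theta_moment 2 \<tau> z * theta_moment 4 \<tau> z
      + 2 * theta_moment 3 \<tau> z ^ 2 = 0"
    unfolding R41 by (rule zero)
  show "1/24 * theta_moment 0 \<tau> z ^ 2 * E2 \<tau> ^ 2
      - 1/24 * theta_moment 0 \<tau> z ^ 2 * E4 \<tau>
      - theta_moment 0 \<tau> z * theta_moment 2 \<tau> z * E2 \<tau>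
      + theta_moment 0 \<tau> z * theta_moment 4 \<tau> z + theta_moment 1 \<tau> z ^ 2 * E2 \<tau>
      - 4 * theta_moment 1 \<tau> z * theta_moment 3 \<tau> z + 3 * theta_moment 2 \<tau> z ^ 2 = 0" "1/12 * theta_moment 0 \<tau> z * theta_moment 1 \<tau> z * E2 \<tau> ^ 2
      - 1/12 * theta_moment 0 \<tau> z * theta_moment 1 \<tau> z * E4 \<tau>
      - theta_moment 0 \<tau> z * theta_moment 3 \<tau> z * E2 \<tau>
      + theta_moment 0 \<tau> z * theta_moment 5 \<tau> z
      + theta_moment 1 \<tau> z * theta_moment 2 \<tau> z * E2 \<tau>
      - 3 * theta_moment 1 \<tau> z * theta_moment 4 \<tau> z
      + 2 * theta_moment 2 \<tau> z * theta_moment 3 \<tau> z = 0"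
    by (rule R4 R41)+
qed

section \<open>Evaluation of the three operators on the fourth power of theta\<close>

text \<open>The first \<open>z\<close>-derivative is required at every point because it is
  differentiated again; the other two only at the point of evaluation.\<close>

lemma Hk_eqI:
  assumes "\<And>w. ((\<lambda>w. f \<tau> w) has_field_derivative 2 * pi * \<i> * f1 w) (at w)"
    and "(f1 has_field_derivative 2 * pi * \<i> * f2) (at z)"
    and "((\<lambda>t. f t z) has_field_derivative 2 * pi * \<i> * g) (at \<tau>)"
  shows "Hk k f \<tau> z = 12 * g - 3/2 * f2 - (2 * of_nat k - 1) / 2 * E2 \<tau> * f \<tau> z"
proof -
  have "Dzeta f \<tau> = f1"
    using assms(1)[THEN DERIV_imp_deriv] by (simp add: Dzeta_def fun_eq_iff)
  then have "Dzeta (Dzeta f) \<tau> z = f2"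
    using assms(2)[THEN DERIV_imp_deriv] by (simp add: Dzeta_def[of "Dzeta f"])
  moreover have "Dq f \<tau> z = g"
    using assms(3)[THEN DERIV_imp_deriv] by (simp add: Dq_def)
  ultimately show ?thesis
    by (simp add: Hk_def heat2_def)
qed

text \<open>The operator sees \<open>f\<close> only near tau, and the half-plane is open. This
  allows closed forms valid only there to be substituted under the next operator.\<close>

lemma Hk_cong:
  assumes "Im \<tau> > 0" and eq: "\<And>t w. Im t > 0 \<Longrightarrow> f t w = g t w"
  shows "Hk k f \<tau> z = Hk k g \<tau> z"
proof -
  have "f \<tau> = g \<tau>"
    using eq[OF assms(1)] by blast
  then have z: "Dzeta f \<tau> = Dzeta g \<tau>"
    by (simp add: Dzeta_def fun_eq_iff)
  have "\<forall>\<^sub>F t in nhds \<tau>. t \<in> {t. Im t > 0}"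
    using assms(1) by (intro eventually_nhds_in_open open_halfspace_Im_gt) auto
  then have "\<forall>\<^sub>F t in nhds \<tau>. f t z = g t z"
    by eventually_elim (simp add: eq)
  then have "deriv (\<lambda>t. f t z) \<tau> = deriv (\<lambda>t. g t z) \<tau>"
    by (rule deriv_cong_ev) simp
  then show ?thesis
    unfolding Hk_def heat2_def Dzeta_def[of "Dzeta _"] z Dq_def eq[OF assms(1)] by simp
qed

text \<open>With \<open>W = \<theta>\<^sup>2 \<wp>\<close>, the next two expressions are
  \<open>- 18 \<theta>\<^sup>2 W\<close> and \<open>54 W\<^sup>2 + 39/8 E\<^sub>4 \<theta>\<^sup>4\<close>.\<close>

definition theta4_H2 :: "complex \<Rightarrow> complex \<Rightarrow> complex" where
  "theta4_H2 \<tau> z = - 3/2 * theta_moment 0 \<tau> z ^ 4 * E2 \<tau>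
      + 18 * theta_moment 0 \<tau> z ^ 3 * theta_moment 2 \<tau> z
      - 18 * theta_moment 0 \<tau> z ^ 2 * theta_moment 1 \<tau> z ^ 2"

definition theta4_H4H2 :: "complex \<Rightarrow> complex \<Rightarrow> complex" where
  "theta4_H4H2 \<tau> z = 3/8 * theta_moment 0 \<tau> z ^ 4 * E2 \<tau> ^ 2
      + 39/8 * theta_moment 0 \<tau> z ^ 4 * E4 \<tau>
      - 9 * theta_moment 0 \<tau> z ^ 3 * theta_moment 2 \<tau> z * E2 \<tau>
      + 9 * theta_moment 0 \<tau> z ^ 2 * theta_moment 1 \<tau> z ^ 2 * E2 \<tau>
      + 54 * theta_moment 0 \<tau> z ^ 2 * theta_moment 2 \<tau> z ^ 2
      - 108 * theta_moment 0 \<tau> z * theta_moment 1 \<tau> z ^ 2 * theta_moment 2 \<tau> z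
      + 54 * theta_moment 1 \<tau> z ^ 4"

lemma Hk_2_theta4:
  assumes "Im \<tau> > 0"
  shows "Hk 2 (\<lambda>t w. theta_moment 0 t w ^ 4) \<tau> z = theta4_H2 \<tau> z"
proof -
  note dz = theta_moment_has_field_derivative_z_numeral[OF assms]
    and dt = theta_moment_has_field_derivative_tau_numeral[OF assms]
  have 1: "((\<lambda>w. theta_moment 0 \<tau> w ^ 4) has_field_derivative 2 * pi * \<i> * (4 * theta_moment 0 \<tau> w ^ 3 * theta_moment 1 \<tau> w)) (at w)" for w
    by (rule derivative_eq_intros dz refl)+ (simp only: of_nat_numeral pred_small_numerals, algebra)
  have 2: "((\<lambda>w. 4 * theta_moment 0 \<tau> w ^ 3 * theta_moment 1 \<tau> w) has_field_derivative 2 * pi * \<i> * (4 * theta_moment 0 \<tau> z ^ 3 * theta_moment 2 \<tau> z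
      + 12 * theta_moment 0 \<tau> z ^ 2 * theta_moment 1 \<tau> z ^ 2)) (at z)"
    by (rule derivative_eq_intros dz refl)+ (simp only: of_nat_numeral pred_small_numerals power_one_right, algebra)
  have 3: "((\<lambda>\<tau>. theta_moment 0 \<tau> z ^ 4) has_field_derivative 2 * pi * \<i> * (2 * theta_moment 0 \<tau> z ^ 3 * theta_moment 2 \<tau> z)) (at \<tau>)"
    by (rule derivative_eq_intros dt refl)+ (simp only: of_nat_numeral pred_small_numerals, algebra)
  show ?thesis
    by (simp add: Hk_eqI[where f = "\<lambda>t w. theta_moment 0 t w ^ 4", OF 1 2 3] theta4_H2_def field_simps)
qed

lemma Hk_4_theta4:
  assumes "Im \<tau> > 0"
  shows "Hk 4 theta4_H2 \<tau> z = theta4_H4H2 \<tau> z"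
proof -
  note dz = theta_moment_has_field_derivative_z_numeral[OF assms]
    and dt = theta_moment_has_field_derivative_tau_numeral[OF assms]
    and dE = E2_has_field_derivative[OF assms]
  have 1: "((\<lambda>w. theta4_H2 \<tau> w) has_field_derivative 2 * pi * \<i> * (- 6 * theta_moment 0 \<tau> w ^ 3 * theta_moment 1 \<tau> w * E2 \<tau>
      + 18 * theta_moment 0 \<tau> w ^ 3 * theta_moment 3 \<tau> w
      + 18 * theta_moment 0 \<tau> w ^ 2 * theta_moment 1 \<tau> w * theta_moment 2 \<tau> w
      - 36 * theta_moment 0 \<tau> w * theta_moment 1 \<tau> w ^ 3)) (at w)" for w
    unfolding theta4_H2_def by (rule derivative_eq_intros dz refl)+ (simp only: of_nat_numeral pred_small_numerals power_one_right, algebra)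
  have 2: "((\<lambda>w. - 6 * theta_moment 0 \<tau> w ^ 3 * theta_moment 1 \<tau> w * E2 \<tau>
      + 18 * theta_moment 0 \<tau> w ^ 3 * theta_moment 3 \<tau> w
      + 18 * theta_moment 0 \<tau> w ^ 2 * theta_moment 1 \<tau> w * theta_moment 2 \<tau> w
      - 36 * theta_moment 0 \<tau> w * theta_moment 1 \<tau> w ^ 3) has_field_derivative 2 * pi * \<i> * (- 6 * theta_moment 0 \<tau> z ^ 3 * theta_moment 2 \<tau> z * E2 \<tau>
      + 18 * theta_moment 0 \<tau> z ^ 3 * theta_moment 4 \<tau> z
      - 18 * theta_moment 0 \<tau> z ^ 2 * theta_moment 1 \<tau> z ^ 2 * E2 \<tau>
      + 72 * theta_moment 0 \<tau> z ^ 2 * theta_moment 1 \<tau> z * theta_moment 3 \<tau> z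
      + 18 * theta_moment 0 \<tau> z ^ 2 * theta_moment 2 \<tau> z ^ 2
      - 72 * theta_moment 0 \<tau> z * theta_moment 1 \<tau> z ^ 2 * theta_moment 2 \<tau> z
      - 36 * theta_moment 1 \<tau> z ^ 4)) (at z)"
    by (rule derivative_eq_intros dz refl)+ (simp only: of_nat_numeral pred_small_numerals power_one_right, algebra)
  have 3: "((\<lambda>\<tau>. theta4_H2 \<tau> z) has_field_derivative 2 * pi * \<i> * (- 1/8 * theta_moment 0 \<tau> z ^ 4 * E2 \<tau> ^ 2
      + 1/8 * theta_moment 0 \<tau> z ^ 4 * E4 \<tau>
      - 3 * theta_moment 0 \<tau> z ^ 3 * theta_moment 2 \<tau> z * E2 \<tau>
      + 9 * theta_moment 0 \<tau> z ^ 3 * theta_moment 4 \<tau> z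
      - 18 * theta_moment 0 \<tau> z ^ 2 * theta_moment 1 \<tau> z * theta_moment 3 \<tau> z
      + 27 * theta_moment 0 \<tau> z ^ 2 * theta_moment 2 \<tau> z ^ 2
      - 18 * theta_moment 0 \<tau> z * theta_moment 1 \<tau> z ^ 2 * theta_moment 2 \<tau> z)) (at \<tau>)"
    unfolding theta4_H2_def by (rule derivative_eq_intros dt dE refl)+ (simp only: of_nat_numeral pred_small_numerals power_one_right, algebra)
  \<comment> \<open>Subtracting \<open>81 * theta_moment 0 \<tau> z ^ 2\<close> times the first
    relation removes the moments of orders 3 and 4 together.\<close>
  show ?thesis
    using theta_relations(1)[OF assms, of z]
    unfolding Hk_eqI[OF 1 2 3] theta4_H2_def theta4_H4H2_def by (simp only: of_nat_numeral) algebra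
qed

text \<open>The square of \<open>theta_moment 3\<close> is matched by the difference of the two
  relations of order 6, in which \<open>theta_moment 6\<close> cancels; the second relation cancels
  the \<open>theta_moment 5\<close> left over, and the first accounts for the remaining
  terms.\<close>

lemma Hk_6_theta4:
  assumes "Im \<tau> > 0"
  shows "Hk 6 theta4_H4H2 \<tau> z = 23/4 * E4 \<tau> * theta4_H2 \<tau> z - 81/4 * E6 \<tau> * theta_moment 0 \<tau> z ^ 4"
proof -
  note dz = theta_moment_has_field_derivative_z_numeral[OF assms]
    and dt = theta_moment_has_field_derivative_tau_numeral[OF assms]
    and dE = E2_has_field_derivative[OF assms] E4_has_field_derivative[OF assms]
  have 1: "((\<lambda>w. theta4_H4H2 \<tau> w) has_field_derivative 2 * pi * \<i> * (3/2 * theta_moment 0 \<tau> w ^ 3 * theta_moment 1 \<tau> w * E2 \<tau> ^ 2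
      + 39/2 * theta_moment 0 \<tau> w ^ 3 * theta_moment 1 \<tau> w * E4 \<tau>
      - 9 * theta_moment 0 \<tau> w ^ 3 * theta_moment 3 \<tau> w * E2 \<tau>
      - 9 * theta_moment 0 \<tau> w ^ 2 * theta_moment 1 \<tau> w * theta_moment 2 \<tau> w * E2 \<tau>
      + 108 * theta_moment 0 \<tau> w ^ 2 * theta_moment 2 \<tau> w * theta_moment 3 \<tau> w
      + 18 * theta_moment 0 \<tau> w * theta_moment 1 \<tau> w ^ 3 * E2 \<tau>
      - 108 * theta_moment 0 \<tau> w * theta_moment 1 \<tau> w ^ 2 * theta_moment 3 \<tau> w
      - 108 * theta_moment 0 \<tau> w * theta_moment 1 \<tau> w * theta_moment 2 \<tau> w ^ 2
      + 108 * theta_moment 1 \<tau> w ^ 3 * theta_moment 2 \<tau> w)) (at w)" for w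
    unfolding theta4_H4H2_def by (rule derivative_eq_intros dz refl)+ (simp only: of_nat_numeral pred_small_numerals power_one_right, algebra)
  have 2: "((\<lambda>w. 3/2 * theta_moment 0 \<tau> w ^ 3 * theta_moment 1 \<tau> w * E2 \<tau> ^ 2
      + 39/2 * theta_moment 0 \<tau> w ^ 3 * theta_moment 1 \<tau> w * E4 \<tau>
      - 9 * theta_moment 0 \<tau> w ^ 3 * theta_moment 3 \<tau> w * E2 \<tau>
      - 9 * theta_moment 0 \<tau> w ^ 2 * theta_moment 1 \<tau> w * theta_moment 2 \<tau> w * E2 \<tau>
      + 108 * theta_moment 0 \<tau> w ^ 2 * theta_moment 2 \<tau> w * theta_moment 3 \<tau> w
      + 18 * theta_moment 0 \<tau> w * theta_moment 1 \<tau> w ^ 3 * E2 \<tau>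
      - 108 * theta_moment 0 \<tau> w * theta_moment 1 \<tau> w ^ 2 * theta_moment 3 \<tau> w
      - 108 * theta_moment 0 \<tau> w * theta_moment 1 \<tau> w * theta_moment 2 \<tau> w ^ 2
      + 108 * theta_moment 1 \<tau> w ^ 3 * theta_moment 2 \<tau> w) has_field_derivative 2 * pi * \<i> * (3/2 * theta_moment 0 \<tau> z ^ 3 * theta_moment 2 \<tau> z * E2 \<tau> ^ 2
      + 39/2 * theta_moment 0 \<tau> z ^ 3 * theta_moment 2 \<tau> z * E4 \<tau>
      - 9 * theta_moment 0 \<tau> z ^ 3 * theta_moment 4 \<tau> z * E2 \<tau>
      + 9/2 * theta_moment 0 \<tau> z ^ 2 * theta_moment 1 \<tau> z ^ 2 * E2 \<tau> ^ 2
      + 117/2 * theta_moment 0 \<tau> z ^ 2 * theta_moment 1 \<tau> z ^ 2 * E4 \<tau>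
      - 36 * theta_moment 0 \<tau> z ^ 2 * theta_moment 1 \<tau> z * theta_moment 3 \<tau> z * E2 \<tau>
      - 9 * theta_moment 0 \<tau> z ^ 2 * theta_moment 2 \<tau> z ^ 2 * E2 \<tau>
      + 108 * theta_moment 0 \<tau> z ^ 2 * theta_moment 2 \<tau> z * theta_moment 4 \<tau> z
      + 108 * theta_moment 0 \<tau> z ^ 2 * theta_moment 3 \<tau> z ^ 2
      + 36 * theta_moment 0 \<tau> z * theta_moment 1 \<tau> z ^ 2 * theta_moment 2 \<tau> z * E2 \<tau>
      - 108 * theta_moment 0 \<tau> z * theta_moment 1 \<tau> z ^ 2 * theta_moment 4 \<tau> z
      - 216 * theta_moment 0 \<tau> z * theta_moment 1 \<tau> z * theta_moment 2 \<tau> z * theta_moment 3 \<tau> z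
      - 108 * theta_moment 0 \<tau> z * theta_moment 2 \<tau> z ^ 3
      + 18 * theta_moment 1 \<tau> z ^ 4 * E2 \<tau>
      + 216 * theta_moment 1 \<tau> z ^ 2 * theta_moment 2 \<tau> z ^ 2)) (at z)"
    by (rule derivative_eq_intros dz refl)+ (simp only: of_nat_numeral pred_small_numerals power_one_right, algebra)
  have 3: "((\<lambda>\<tau>. theta4_H4H2 \<tau> z) has_field_derivative 2 * pi * \<i> * (1/16 * theta_moment 0 \<tau> z ^ 4 * E2 \<tau> ^ 3
      + 25/16 * theta_moment 0 \<tau> z ^ 4 * E2 \<tau> * E4 \<tau>
      - 13/8 * theta_moment 0 \<tau> z ^ 4 * E6 \<tau>
      + 21/2 * theta_moment 0 \<tau> z ^ 3 * theta_moment 2 \<tau> z * E4 \<tau>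
      - 9/2 * theta_moment 0 \<tau> z ^ 3 * theta_moment 4 \<tau> z * E2 \<tau>
      + 3/4 * theta_moment 0 \<tau> z ^ 2 * theta_moment 1 \<tau> z ^ 2 * E2 \<tau> ^ 2
      - 3/4 * theta_moment 0 \<tau> z ^ 2 * theta_moment 1 \<tau> z ^ 2 * E4 \<tau>
      + 9 * theta_moment 0 \<tau> z ^ 2 * theta_moment 1 \<tau> z * theta_moment 3 \<tau> z * E2 \<tau>
      - 27/2 * theta_moment 0 \<tau> z ^ 2 * theta_moment 2 \<tau> z ^ 2 * E2 \<tau>
      + 54 * theta_moment 0 \<tau> z ^ 2 * theta_moment 2 \<tau> z * theta_moment 4 \<tau> z
      + 9 * theta_moment 0 \<tau> z * theta_moment 1 \<tau> z ^ 2 * theta_moment 2 \<tau> z * E2 \<tau>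
      - 54 * theta_moment 0 \<tau> z * theta_moment 1 \<tau> z ^ 2 * theta_moment 4 \<tau> z
      - 108 * theta_moment 0 \<tau> z * theta_moment 1 \<tau> z * theta_moment 2 \<tau> z * theta_moment 3 \<tau> z
      + 54 * theta_moment 0 \<tau> z * theta_moment 2 \<tau> z ^ 3
      + 108 * theta_moment 1 \<tau> z ^ 3 * theta_moment 3 \<tau> z
      - 54 * theta_moment 1 \<tau> z ^ 2 * theta_moment 2 \<tau> z ^ 2)) (at \<tau>)"
    unfolding theta4_H4H2_def by (rule derivative_eq_intros dt dE refl)+ (simp only: of_nat_numeral pred_small_numerals power_one_right, algebra)
  \<comment> \<open>The multipliers are found by eliminating the moments of order 6, 5 and 4 in turn.\<close>
  note rel = theta_relations[OF assms, of z]
  have "Hk 6 theta4_H4H2 \<tau> z - (23/4 * E4 \<tau> * theta4_H2 \<tau> z - 81/4 * E6 \<tau> * theta_moment 0 \<tau> z ^ 4)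
    = 27/2 * theta_moment 0 \<tau> z ^ 2 * ((5/72 * theta_moment 0 \<tau> z ^ 2 * E2 \<tau> ^ 3
      - 1/8 * theta_moment 0 \<tau> z ^ 2 * E2 \<tau> * E4 \<tau>
      + 1/18 * theta_moment 0 \<tau> z ^ 2 * E6 \<tau>
      - 5/4 * theta_moment 0 \<tau> z * theta_moment 2 \<tau> z * E2 \<tau> ^ 2
      + 1/4 * theta_moment 0 \<tau> z * theta_moment 2 \<tau> z * E4 \<tau>
      + theta_moment 0 \<tau> z * theta_moment 6 \<tau> z
      + 5/4 * theta_moment 1 \<tau> z ^ 2 * E2 \<tau> ^ 2
      - 1/4 * theta_moment 1 \<tau> z ^ 2 * E4 \<tau>
      - 6 * theta_moment 1 \<tau> z * theta_moment 5 \<tau> z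
      + 15 * theta_moment 2 \<tau> z * theta_moment 4 \<tau> z - 10 * theta_moment 3 \<tau> z ^ 2)
      - (1/12 * theta_moment 0 \<tau> z * theta_moment 2 \<tau> z * E2 \<tau> ^ 2
      - 1/12 * theta_moment 0 \<tau> z * theta_moment 2 \<tau> z * E4 \<tau>
      - theta_moment 0 \<tau> z * theta_moment 4 \<tau> z * E2 \<tau>
      + theta_moment 0 \<tau> z * theta_moment 6 \<tau> z
      + 1/12 * theta_moment 1 \<tau> z ^ 2 * E2 \<tau> ^ 2
      - 1/12 * theta_moment 1 \<tau> z ^ 2 * E4 \<tau>
      - 2 * theta_moment 1 \<tau> z * theta_moment 5 \<tau> z
      + theta_moment 2 \<tau> z ^ 2 * E2 \<tau> - theta_moment 2 \<tau> z * theta_moment 4 \<tau> z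
      + 2 * theta_moment 3 \<tau> z ^ 2))
      + 54 * theta_moment 0 \<tau> z * theta_moment 1 \<tau> z * (1/12 * theta_moment 0 \<tau> z * theta_moment 1 \<tau> z * E2 \<tau> ^ 2
      - 1/12 * theta_moment 0 \<tau> z * theta_moment 1 \<tau> z * E4 \<tau>
      - theta_moment 0 \<tau> z * theta_moment 3 \<tau> z * E2 \<tau>
      + theta_moment 0 \<tau> z * theta_moment 5 \<tau> z
      + theta_moment 1 \<tau> z * theta_moment 2 \<tau> z * E2 \<tau>
      - 3 * theta_moment 1 \<tau> z * theta_moment 4 \<tau> z
      + 2 * theta_moment 2 \<tau> z * theta_moment 3 \<tau> z)
      + (270 * theta_moment 0 \<tau> z * theta_moment 2 \<tau> z - 324 * theta_moment 1 \<tau> z ^ 2 - 54 * E2 \<tau> * theta_moment 0 \<tau> z ^ 2)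
        * (1/24 * theta_moment 0 \<tau> z ^ 2 * E2 \<tau> ^ 2
      - 1/24 * theta_moment 0 \<tau> z ^ 2 * E4 \<tau>
      - theta_moment 0 \<tau> z * theta_moment 2 \<tau> z * E2 \<tau>
      + theta_moment 0 \<tau> z * theta_moment 4 \<tau> z + theta_moment 1 \<tau> z ^ 2 * E2 \<tau>
      - 4 * theta_moment 1 \<tau> z * theta_moment 3 \<tau> z + 3 * theta_moment 2 \<tau> z ^ 2)"
    unfolding Hk_eqI[OF 1 2 3] theta4_H2_def theta4_H4H2_def by (simp only: of_nat_numeral) algebra
  then show ?thesis
    unfolding rel by simp
qed

theorem theorem3p1:
  fixes \<tau> z :: complex
  assumes "Im \<tau> > 0"
  shows "Hk 6 (Hk 4 (Hk 2 (\<lambda>t w. jtheta t w ^ 4))) \<tau> z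
           - 23/4 * E4 \<tau> * Hk 2 (\<lambda>t w. jtheta t w ^ 4) \<tau> z
           + 81/4 * E6 \<tau> * jtheta \<tau> z ^ 4 = 0"
proof -
  \<comment> \<open>The closed forms are stated on the whole half-plane, not just at tau, since the
    next operator differentiates in tau.\<close>
  have H2: "Hk 2 (\<lambda>t w. jtheta t w ^ 4) t w = theta4_H2 t w" if "Im t > 0" for t w
    unfolding jtheta_eq_theta_moment by (rule Hk_2_theta4[OF that])
  have "Hk 4 (Hk 2 (\<lambda>t w. jtheta t w ^ 4)) t w = Hk 4 theta4_H2 t w" if "Im t > 0" for t w
    using that by (intro Hk_cong H2)
  then have H4: "Hk 4 (Hk 2 (\<lambda>t w. jtheta t w ^ 4)) t w = theta4_H4H2 t w" if "Im t > 0" for t w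
    using that by (simp only: Hk_4_theta4)
  have "Hk 6 (Hk 4 (Hk 2 (\<lambda>t w. jtheta t w ^ 4))) \<tau> z = Hk 6 theta4_H4H2 \<tau> z"
    using assms by (intro Hk_cong H4)
  then have H6: "Hk 6 (Hk 4 (Hk 2 (\<lambda>t w. jtheta t w ^ 4))) \<tau> z
      = 23/4 * E4 \<tau> * theta4_H2 \<tau> z - 81/4 * E6 \<tau> * theta_moment 0 \<tau> z ^ 4"
    by (simp only: Hk_6_theta4[OF assms])
  show ?thesis
    unfolding H6 H2[OF assms] by (simp add: jtheta_eq_theta_moment)
qed

end
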